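(* Let $F\in\mathcal U^\tau$ and $x_0\in H$. Then there exists a unique $U\in\mathcal U^\tau$ (taking values in $D(A)$ on each $I_m$, so that $AU$ is defined) such that for all $\Phi\in\mathcal U^\tau$ and all $m\in\{1,\dots,M\}$ $$Q_m\big[(\partial_t M_0+M_1+A)U,\Phi\big]_\rho+\big\langle M_0[[U]]_{m-1}^{x_0},\Phi(t_{m-1}+)\big\rangle_H=Q_m[F,\Phi]_\rho .$$
   Context: $H$ is a real Hilbert space with inner product $\langle\cdot,\cdot\rangle_H$. $M_0,M_1:H\to H$ are bounded linear operators, $M_0$ is selfadjoint, and $A:D(A)\subseteq H\to H$ is skew-selfadjoint, i.e. $A^*=-A$. There are $\rho_0>0$ and $\gamma>0$ such that $\langle(\rho M_0+M_1)x,x\rangle_H\ge\gamma\langle x,x\rangle_H$ for all $\rho\ge\rho_0$ and $x\in H$. Fix $\rho\ge\rho_0$, $T>0$, $q\in\mathbb N$, and a partition $0=t_0<t_1<\dots<t_M=T$; put $I_m=(t_{m-1},t_m]$ and $\tau_m=t_m-t_{m-1}$. $\mathcal P_q(I_m;H)$ is the space of $H$-valued polynomials of degree at most $q$ on $I_m$. $\mathcal U^\tau$ is the space of functions $u:(0,T]\to H$ with $u|_{I_m}\in\mathcal P_q(I_m;H)$ for all $m\in\{1,\dots,M\}$. The operator $\partial_t$ acts on $u\in\mathcal U^\tau$ piecewise (as the derivative of the polynomial $u|_{I_m}$ on each $I_m$), and $M_0,M_1,A$ act pointwise in $t$. Quadrature: $-1<\hat t^m_0<\dots<\hat t^m_q=1$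 and $\omega^m_i$ ($i=0,\dots,q$) are the nodes and weights of the right-sided weighted Gauss–Radau rule with $q+1$ nodes on $(-1,1]$, i.e. $\int_{-1}^1 e^{-\rho\tau_m(t+1)}p(t)\,dt=\sum_{i=0}^q\omega^m_i p(\hat t^m_i)$ for all polynomials $p$ of degree at most $2q$. With $t_{m,i}=\frac{t_{m-1}+t_m}{2}+\frac{\tau_m}{2}\hat t^m_i$ set $Q_m[v]=\frac{\tau_m}{2}\sum_{i=0}^q\omega^m_i v(t_{m,i})$ and $Q_m[a,b]_\rho=Q_m[\langle a,b\rangle_H]$. Jumps: $[[U]]_{m-1}^{x_0}=U(t_{m-1}+)-U(t_{m-1}-)$ for $m\in\{2,\dots,M\}$, and $[[U]]_{0}^{x_0}=U(t_0+)-x_0$ for $m=1$; here $\pm$ denote one-sided limits. *)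

theory Defs
  imports
    "HOL-Analysis.Analysis"
    "HOL-Library.FuncSet"
    "HOL-Computational_Algebra.Polynomial"
begin

section \<open>Unbounded operators\<close>

text \<open>
  An operator in \<open>'h\<close> is a pair of its domain \<open>D\<close> and a function \<open>A\<close>; the values of \<open>A\<close>
  outside \<open>D\<close> are irrelevant.
\<close>

definition densely_defined_linear :: "'h::real_inner set \<Rightarrow> ('h \<Rightarrow> 'h) \<Rightarrow> bool" where
  "densely_defined_linear D A \<longleftrightarrow>
     subspace D \<and> closure D = UNIV \<and>
     (\<forall>x\<in>D. \<forall>y\<in>D. A (x + y) = A x + A y) \<and>
     (\<forall>c. \<forall>x\<in>D. A (c *\<^sub>R x) = c *\<^sub>R A x)"

definition adjoint_dom :: "'h::real_inner set \<Rightarrow> ('h \<Rightarrow> 'h) \<Rightarrow> 'h set" where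
  "adjoint_dom D A = {y. \<exists>z. \<forall>x\<in>D. A x \<bullet> y = x \<bullet> z}"

text \<open>The description is unique because it is only used for dense \<open>D\<close> and \<open>y\<close> in \<open>adjoint_dom D A\<close>.\<close>

definition adjoint_op :: "'h::real_inner set \<Rightarrow> ('h \<Rightarrow> 'h) \<Rightarrow> 'h \<Rightarrow> 'h" where
  "adjoint_op D A y = (THE z. \<forall>x\<in>D. A x \<bullet> y = x \<bullet> z)"

definition skew_selfadjoint :: "'h::real_inner set \<Rightarrow> ('h \<Rightarrow> 'h) \<Rightarrow> bool" where
  "skew_selfadjoint D A \<longleftrightarrow>
     densely_defined_linear D A \<and>
     adjoint_dom D A = D \<and> (\<forall>y\<in>D. adjoint_op D A y = - A y)"

definition bounded_selfadjoint :: "('h::real_inner \<Rightarrow> 'h) \<Rightarrow> bool" where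
  "bounded_selfadjoint B \<longleftrightarrow> bounded_linear B \<and> (\<forall>x y. B x \<bullet> y = x \<bullet> B y)"


section \<open>Piecewise polynomials in time\<close>

text \<open>A time grid is a sequence \<open>t\<close> of which only \<open>t 0, \<dots>, t M\<close> matter; slabs are numbered from 1.\<close>

definition is_partition :: "real \<Rightarrow> nat \<Rightarrow> (nat \<Rightarrow> real) \<Rightarrow> bool" where
  "is_partition T M t \<longleftrightarrow> t 0 = 0 \<and> t M = T \<and> (\<forall>m<M. t m < t (Suc m))"

definition slab :: "(nat \<Rightarrow> real) \<Rightarrow> nat \<Rightarrow> real set" where
  "slab t m = {t (m - 1)<..t m}"

definition step :: "(nat \<Rightarrow> real) \<Rightarrow> nat \<Rightarrow> real" where
  "step t m = t m - t (m - 1)"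

definition poly_on :: "nat \<Rightarrow> real set \<Rightarrow> (real \<Rightarrow> 'h::real_vector) \<Rightarrow> bool" where
  "poly_on q I u \<longleftrightarrow> (\<exists>c. \<forall>s\<in>I. u s = (\<Sum>k\<le>q. s ^ k *\<^sub>R c k))"

text \<open>
  Functions on \<open>(0,T]\<close> are represented by functions on the reals that are \<open>undefined\<close> outside
  \<open>(0,T]\<close>, so that equality of functions is equality on \<open>(0,T]\<close>.
\<close>

definition pw_poly_space :: "real \<Rightarrow> nat \<Rightarrow> (nat \<Rightarrow> real) \<Rightarrow> nat \<Rightarrow> (real \<Rightarrow> 'h::real_vector) set" where
  "pw_poly_space T M t q =
     {u \<in> extensional {0<..T}. \<forall>m\<in>{1..M}. poly_on q (slab t m) u}"

text \<open>
  The derivative of the \<open>m\<close>-th piece at points of the \<open>m\<close>-th slab; it is taken within the slab,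
  hence from the left at the right end point, where \<open>u\<close> may jump.
\<close>

definition slab_deriv ::
    "(nat \<Rightarrow> real) \<Rightarrow> nat \<Rightarrow> (real \<Rightarrow> 'h::real_normed_vector) \<Rightarrow> real \<Rightarrow> 'h" where
  "slab_deriv t m u s = vector_derivative u (at s within slab t m)"

definition right_limit :: "(real \<Rightarrow> 'h::t2_space) \<Rightarrow> real \<Rightarrow> 'h" where
  "right_limit u s = Lim (at_right s) u"

definition left_limit :: "(real \<Rightarrow> 'h::t2_space) \<Rightarrow> real \<Rightarrow> 'h" where
  "left_limit u s = Lim (at_left s) u"

text \<open>\<open>jump t x0 u m\<close> is the jump at \<open>t (m - 1)\<close>, the left end point of the \<open>m\<close>-th slab.\<close>

definition jump ::
    "(nat \<Rightarrow> real) \<Rightarrow> 'h::real_normed_vector \<Rightarrow> (real \<Rightarrow> 'h) \<Rightarrow> nat \<Rightarrow> 'h" where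
  "jump t x0 u m =
     right_limit u (t (m - 1)) - (if m = 1 then x0 else left_limit u (t (m - 1)))"


section \<open>Weighted Gauss--Radau quadrature\<close>

definition gauss_radau :: "real \<Rightarrow> nat \<Rightarrow> (nat \<Rightarrow> real) \<Rightarrow> (nat \<Rightarrow> real) \<Rightarrow> bool" where
  "gauss_radau \<sigma> q x w \<longleftrightarrow>
     - 1 < x 0 \<and> (\<forall>i<q. x i < x (Suc i)) \<and> x q = 1 \<and>
     (\<forall>p :: real poly. degree p \<le> 2 * q \<longrightarrow>
        integral {-1..1} (\<lambda>s. exp (- \<sigma> * (s + 1)) * poly p s) = (\<Sum>i\<le>q. w i * poly p (x i)))"

definition quad_node :: "(nat \<Rightarrow> real) \<Rightarrow> (nat \<Rightarrow> nat \<Rightarrow> real) \<Rightarrow> nat \<Rightarrow> nat \<Rightarrow> real" where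
  "quad_node t x m i = (t (m - 1) + t m) / 2 + step t m / 2 * x m i"

definition quad ::
    "(nat \<Rightarrow> real) \<Rightarrow> nat \<Rightarrow> (nat \<Rightarrow> nat \<Rightarrow> real) \<Rightarrow> (nat \<Rightarrow> nat \<Rightarrow> real) \<Rightarrow> nat \<Rightarrow>
     (real \<Rightarrow> real) \<Rightarrow> real" where
  "quad t q x w m v = step t m / 2 * (\<Sum>i\<le>q. w m i * v (quad_node t x m i))"

definition quad_inner ::
    "(nat \<Rightarrow> real) \<Rightarrow> nat \<Rightarrow> (nat \<Rightarrow> nat \<Rightarrow> real) \<Rightarrow> (nat \<Rightarrow> nat \<Rightarrow> real) \<Rightarrow> nat \<Rightarrow>
     (real \<Rightarrow> 'h::real_inner) \<Rightarrow> (real \<Rightarrow> 'h) \<Rightarrow> real" where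
  "quad_inner t q x w m a b = quad t q x w m (\<lambda>s. a s \<bullet> b s)"

end

theory Submission
  imports Defs
begin

text \<open>\<open>A\<close> is unbounded, so a norm bound for \<open>B + A\<close> is out of reach.
  Only the resolvent of \<open>A\<close> on the space \<open>H\<close> itself is constructed; acting
  on each component it inverts \<open>l + A\<close>, and \<open>B\<close> is absorbed by a fixed
  point argument for large \<open>l\<close>.

  The jump term is tested at the left end of the slab, which is not a quadrature node. It must be
  rewritten as a sum over nodes: dividing the values of the Lagrange polynomials at that end by the
  weights gives the Riesz representative of the trace for the weighted inner product. Both this
  division and the inner product need strictly positive weights, which exactness up to degree
  \<open>2 * q\<close> provides.

  The sign of the boundary terms rests on \<open>M0\<close> being nonnegative. This follows from the
  lower bound because the bound holds for all large parameters; a bound at one parameter would not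
  give it.\<close>

text \<open>
  In terms of the nodal values of \<open>U\<close>, the equation on one slab is \<open>(B + A) V = G\<close> on \<open>H\<close> to the
  power \<open>q + 1\<close>, with \<open>B\<close> bounded and \<open>A\<close> acting on each component. The rule is exact for
  \<open>\<langle>M\<^sub>0 U', U\<rangle>\<close>, so integration by parts turns this term into \<open>\<rho> \<langle>M\<^sub>0 U, U\<rangle>\<close> plus boundary
  terms which, together with the jump term, are nonnegative; by the bound on \<open>\<rho> M\<^sub>0 + M\<^sub>1\<close>,
  \<open>B\<close> is coercive for the inner product given by the quadrature weights. Since \<open>A\<close> is
  skew-selfadjoint, \<open>B + A\<close> is bijective. The slabs are solved one after the other, and testing
  with the difference of two solutions gives uniqueness.
\<close>

section \<open>Skew-selfadjoint operators and their resolvents\<close>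

text \<open>The orthogonal vector is the residual of the best approximation in \<open>S\<close> to a
  point outside \<open>S\<close>. A minimising sequence is Cauchy by the parallelogram law, because
  midpoints stay in \<open>S\<close> and so keep at least the minimal distance.\<close>

lemma closed_subspace_proper_orthogonal:
  fixes S :: "'h::{real_inner, complete_space} set"
  assumes S: "subspace S" "closed S" "S \<noteq> UNIV"
  obtains y where "y \<noteq> 0" "\<And>v. v \<in> S \<Longrightarrow> v \<bullet> y = 0"
proof -
  obtain z where z: "z \<notin> S"
    using S(3) by auto
  have ne: "S \<noteq> {}"
    using subspace_0[OF S(1)] by auto
  define d where "d = infdist z S"
  have d0: "d \<ge> 0"
    unfolding d_def by (rule infdist_nonneg)
  have dle: "d \<le> dist z v" if "v \<in> S" for v
    unfolding d_def by (rule infdist_le[OF that])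
  \<comment> \<open>The slack stands under the root so that squaring leaves exactly
    \<open>inverse (Suc n)\<close>, as the parallelogram law requires.\<close>
  have "\<exists>v\<in>S. dist z v < sqrt (d\<^sup>2 + inverse (Suc n))" for n
  proof -
    have "d = sqrt (d\<^sup>2)"
      using d0 by simp
    also have "\<dots> < sqrt (d\<^sup>2 + inverse (Suc n))"
      by (rule real_sqrt_less_mono) simp
    finally have "(INF v\<in>S. dist z v) < sqrt (d\<^sup>2 + inverse (Suc n))"
      unfolding d_def infdist_notempty[OF ne] .
    then show ?thesis
      by (subst (asm) cINF_less_iff) (auto simp: ne)
  qed
  then obtain Y where YS: "\<And>n. Y n \<in> S"
    and Y: "\<And>n. dist z (Y n) < sqrt (d\<^sup>2 + inverse (Suc n))"
    by metis
  have Ysq: "(norm (z - Y n))\<^sup>2 \<le> d\<^sup>2 + inverse (Suc n)" for n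
  proof -
    have "(norm (z - Y n))\<^sup>2 \<le> (sqrt (d\<^sup>2 + inverse (Suc n)))\<^sup>2"
      using Y[of n] by (intro power_mono) (auto simp: dist_norm)
    then show ?thesis by simp
  qed
  have diff: "(norm (Y m - Y n))\<^sup>2 \<le> 2 * inverse (Suc m) + 2 * inverse (Suc n)" for m n
  proof -
    let ?c = "(1/2) *\<^sub>R (Y m + Y n)"
    have "?c \<in> S"
      using YS S(1) by (intro subspace_scale subspace_add)
    then have "d\<^sup>2 \<le> (norm (z - ?c))\<^sup>2"
      using dle[of ?c] d0 by (intro power_mono) (auto simp: dist_norm)
    moreover have "(norm (Y m - Y n))\<^sup>2 + 4 * (norm (z - ?c))\<^sup>2
        = 2 * (norm (z - Y m))\<^sup>2 + 2 * (norm (z - Y n))\<^sup>2"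
      by (simp add: power2_norm_eq_inner algebra_simps inner_commute)
    ultimately show ?thesis
      using Ysq[of m] Ysq[of n] by linarith
  qed
  have "Cauchy Y"
  proof (rule metric_CauchyI)
    fix e :: real assume e: "e > 0"
    then obtain N where N: "inverse (real (Suc N)) < e\<^sup>2 / 4"
      using reals_Archimedean[of "e\<^sup>2 / 4"] by auto
    have "dist (Y m) (Y n) < e" if "m \<ge> N" "n \<ge> N" for m n
    proof -
      have "inverse (real (Suc m)) \<le> inverse (real (Suc N))"
        "inverse (real (Suc n)) \<le> inverse (real (Suc N))"
        using that by (auto intro!: le_imp_inverse_le)
      then have "(norm (Y m - Y n))\<^sup>2 < e\<^sup>2"
        using diff[of m n] N by linarith
      then show ?thesis
        using e by (simp add: dist_norm power_less_imp_less_base)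
    qed
    then show "\<exists>N. \<forall>m\<ge>N. \<forall>n\<ge>N. dist (Y m) (Y n) < e" by blast
  qed
  then obtain y where y: "Y \<longlonglongrightarrow> y"
    using Cauchy_convergent convergent_def by blast
  have yS: "y \<in> S"
    using S(2) YS y closed_sequentially by blast
  have "dist z y \<le> sqrt (d\<^sup>2 + 0)"
  proof (rule LIMSEQ_le)
    show "(\<lambda>n. dist z (Y n)) \<longlonglongrightarrow> dist z y"
      by (intro tendsto_intros y)
    show "(\<lambda>n. sqrt (d\<^sup>2 + inverse (Suc n))) \<longlonglongrightarrow> sqrt (d\<^sup>2 + 0)"
      by (intro tendsto_intros LIMSEQ_inverse_real_of_nat)
    show "\<exists>N. \<forall>n\<ge>N. dist z (Y n) \<le> sqrt (d\<^sup>2 + inverse (Suc n))"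
      using Y less_imp_le by blast
  qed
  then have min: "\<forall>v\<in>S. dist z y \<le> dist z v"
    using dle d0 by force
  have dot: "(z - y) \<bullet> (v - y) \<le> 0" if "v \<in> S" for v
    by (rule any_closest_point_dot[OF subspace_imp_convex[OF S(1)] S(2) yS that min])
  show ?thesis
  proof
    show "z - y \<noteq> 0"
      using z yS by auto
    fix v assume v: "v \<in> S"
    \<comment> \<open>Both \<open>y + v\<close> and \<open>y - v\<close> lie in the subspace, so the
      variational inequality holds for \<open>v\<close> and for \<open>- v\<close>.\<close>
    have "(z - y) \<bullet> ((y + v) - y) \<le> 0" "(z - y) \<bullet> ((y - v) - y) \<le> 0"
      using dot v yS S(1) by (blast intro: subspace_add subspace_diff)+
    then show "v \<bullet> (z - y) = 0"
      by (simp add: inner_commute)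
  qed
qed

lemma dense_orthogonal_zero:
  fixes z :: "'h::real_inner"
  assumes "closure D = UNIV" "\<And>x. x \<in> D \<Longrightarrow> x \<bullet> z = 0"
  shows "z = 0"
proof -
  have "closed {x. x \<bullet> z = 0}"
    by (intro closed_Collect_eq continuous_intros)
  then have "closure D \<subseteq> {x. x \<bullet> z = 0}"
    using assms(2) by (intro closure_minimal) auto
  then have "z \<bullet> z = 0"
    unfolding assms(1) by blast
  then show ?thesis by simp
qed

section \<open>Resolvents of a skew-selfadjoint operator\<close>

context
  fixes D :: "'h::{real_inner, complete_space} set" and A :: "'h \<Rightarrow> 'h"
  assumes skew: "skew_selfadjoint D A"
begin

lemma skew_selfadjoint_domain: "subspace D" "closure D = UNIV"
  using skew by (auto simp: skew_selfadjoint_def densely_defined_linear_def)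

lemma skew_selfadjoint_add: "x \<in> D \<Longrightarrow> y \<in> D \<Longrightarrow> A (x + y) = A x + A y"
  using skew by (auto simp: skew_selfadjoint_def densely_defined_linear_def)

lemma skew_selfadjoint_scale: "x \<in> D \<Longrightarrow> A (c *\<^sub>R x) = c *\<^sub>R A x"
  using skew by (auto simp: skew_selfadjoint_def densely_defined_linear_def)

lemma skew_selfadjoint_diff: "x \<in> D \<Longrightarrow> y \<in> D \<Longrightarrow> A (x - y) = A x - A y"
  using skew_selfadjoint_add[of x "(-1) *\<^sub>R y"] skew_selfadjoint_scale[of y "-1"]
    subspace_scale[OF skew_selfadjoint_domain(1), of y "-1"] by simp

text \<open>Maximality of the domain: an identity tested only against \<open>D\<close> already puts
  \<open>y\<close> into \<open>D\<close>, since the adjoint has no larger domain. Density of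
  \<open>D\<close> makes \<open>z\<close> unique, which evaluates the description in
  \<open>adjoint_op\<close>.\<close>

lemma skew_selfadjoint_adjointI:
  assumes "\<And>x. x \<in> D \<Longrightarrow> A x \<bullet> y = x \<bullet> z"
  shows "y \<in> D" "A y = - z"
proof -
  have "y \<in> adjoint_dom D A"
    using assms by (auto simp: adjoint_dom_def)
  then show y: "y \<in> D"
    using skew by (auto simp: skew_selfadjoint_def)
  have "adjoint_op D A y = z"
    unfolding adjoint_op_def
  proof (rule the_equality)
    fix z' assume "\<forall>x\<in>D. A x \<bullet> y = x \<bullet> z'"
    then have "x \<bullet> (z' - z) = 0" if "x \<in> D" for x
      using assms[OF that] that by (simp add: inner_diff_right)
    then show "z' = z"
      using dense_orthogonal_zero[OF skew_selfadjoint_domain(2)] by fastforce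
  qed (use assms in auto)
  moreover have "adjoint_op D A y = - A y"
    using skew y by (auto simp: skew_selfadjoint_def)
  ultimately show "A y = - z"
    by (simp add: minus_equation_iff)
qed

lemma skew_selfadjoint_skew:
  assumes "x \<in> D" "y \<in> D"
  shows "A x \<bullet> y = - (x \<bullet> A y)"
proof -
  have "y \<in> adjoint_dom D A"
    using skew assms(2) by (auto simp: skew_selfadjoint_def)
  then obtain z where z: "\<And>x. x \<in> D \<Longrightarrow> A x \<bullet> y = x \<bullet> z"
    by (auto simp: adjoint_dom_def)
  then show ?thesis
    using skew_selfadjoint_adjointI(2)[OF z] z[OF assms(1)] by simp
qed

lemma skew_selfadjoint_inner_self: "x \<in> D \<Longrightarrow> A x \<bullet> x = 0"
  using skew_selfadjoint_skew[of x x] by (simp add: inner_commute)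

text \<open>\<open>A x\<close> is orthogonal to \<open>x\<close>, so Pythagoras applies, and the
  square of the norm of \<open>A x\<close> may be dropped.\<close>

lemma skew_selfadjoint_resolvent_bound:
  assumes "x \<in> D" "l > 0"
  shows "l * norm x \<le> norm (l *\<^sub>R x + A x)"
proof -
  have "(l *\<^sub>R x + A x) \<bullet> (l *\<^sub>R x + A x) = l\<^sup>2 * (x \<bullet> x) + A x \<bullet> A x"
    using skew_selfadjoint_inner_self[OF assms(1)]
    by (simp add: inner_left_distrib inner_right_distrib inner_commute power2_eq_square
        del: dot_square_norm)
  then have "l\<^sup>2 * (norm x)\<^sup>2 \<le> (norm (l *\<^sub>R x + A x))\<^sup>2"
    unfolding power2_norm_eq_inner by simp
  then have "(l * norm x)\<^sup>2 \<le> (norm (l *\<^sub>R x + A x))\<^sup>2"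
    by (simp add: power_mult_distrib)
  then show ?thesis
    by (rule power2_le_imp_le) simp
qed

text \<open>The range of \<open>l + A\<close> is closed, because the lower bound makes preimages of
  a convergent sequence Cauchy and \<open>A\<close> is a closed operator. It is everything, because
  a vector orthogonal to it would be an eigenvector of \<open>A\<close> for the eigenvalue
  \<open>l\<close>, contradicting that \<open>A z\<close> is orthogonal to \<open>z\<close>.\<close>

lemma skew_selfadjoint_resolvent_onto:
  assumes l: "l > 0"
  obtains x where "x \<in> D" "l *\<^sub>R x + A x = y"
proof -
  define R where "R = (\<lambda>x. l *\<^sub>R x + A x) ` D"
  have sub: "subspace R"
  proof (rule subspaceI)
    show "0 \<in> R"
      using skew_selfadjoint_scale[of 0 0] subspace_0[OF skew_selfadjoint_domain(1)]
      by (force simp: R_def)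
    fix u v c assume "u \<in> R" "v \<in> R"
    then obtain a b where ab: "a \<in> D" "b \<in> D" "u = l *\<^sub>R a + A a" "v = l *\<^sub>R b + A b"
      by (auto simp: R_def)
    then have "u + v = l *\<^sub>R (a + b) + A (a + b)"
      by (simp add: skew_selfadjoint_add algebra_simps)
    then show "u + v \<in> R"
      using subspace_add[OF skew_selfadjoint_domain(1) ab(1,2)] by (auto simp: R_def)
    have "c *\<^sub>R u = l *\<^sub>R (c *\<^sub>R a) + A (c *\<^sub>R a)"
      using ab by (simp add: skew_selfadjoint_scale algebra_simps)
    then show "c *\<^sub>R u \<in> R"
      unfolding R_def using subspace_scale[OF skew_selfadjoint_domain(1) ab(1)] by (rule image_eqI)
  qed
  have "closed R"
    unfolding closed_sequential_limits
  proof (intro allI impI, elim conjE)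
    fix f u assume f: "\<forall>n. f n \<in> R" and lim: "f \<longlonglongrightarrow> u"
    have "\<forall>n. \<exists>a\<in>D. f n = l *\<^sub>R a + A a"
      using f by (auto simp: R_def)
    then obtain a where a: "\<And>n. a n \<in> D" "\<And>n. f n = l *\<^sub>R a n + A (a n)"
      by metis
    have bnd: "l * dist (a m) (a n) \<le> dist (f m) (f n)" for m n
      using skew_selfadjoint_resolvent_bound[OF subspace_diff[OF skew_selfadjoint_domain(1) a(1) a(1)] l,
          of m n]
      by (simp add: dist_norm a(2) skew_selfadjoint_diff a(1) algebra_simps)
    have "Cauchy a"
    proof (rule metric_CauchyI)
      fix e :: real assume "e > 0"
      then obtain N where "\<forall>m\<ge>N. \<forall>n\<ge>N. dist (f m) (f n) < l * e"
        using metric_CauchyD[OF LIMSEQ_imp_Cauchy[OF lim], of "l * e"] l by auto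
      then have "\<forall>m\<ge>N. \<forall>n\<ge>N. l * dist (a m) (a n) < l * e"
        using bnd by (meson le_less_trans)
      then show "\<exists>N. \<forall>m\<ge>N. \<forall>n\<ge>N. dist (a m) (a n) < e"
        using l by auto
    qed
    then obtain p where p: "a \<longlonglongrightarrow> p"
      using Cauchy_convergent convergent_def by blast
    have Aa: "(\<lambda>n. A (a n)) \<longlonglongrightarrow> u - l *\<^sub>R p"
      using tendsto_diff[OF lim tendsto_scaleR[OF tendsto_const p, of l]] by (simp add: a(2))
    \<comment> \<open>Closedness of \<open>A\<close>: skewness moves \<open>A\<close> from
      \<open>a n\<close> to the fixed vector \<open>v\<close>, where the limit can be taken.\<close>
    have adj: "A v \<bullet> p = v \<bullet> (- (u - l *\<^sub>R p))" if "v \<in> D" for v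
    proof (rule LIMSEQ_unique)
      show "(\<lambda>n. A v \<bullet> a n) \<longlonglongrightarrow> A v \<bullet> p"
        by (intro tendsto_intros p)
      have "(\<lambda>n. v \<bullet> (- A (a n))) \<longlonglongrightarrow> v \<bullet> (- (u - l *\<^sub>R p))"
        by (intro tendsto_intros Aa)
      then show "(\<lambda>n. A v \<bullet> a n) \<longlonglongrightarrow> v \<bullet> (- (u - l *\<^sub>R p))"
        using skew_selfadjoint_skew[OF that a(1)] by simp
    qed
    have "p \<in> D" "A p = u - l *\<^sub>R p"
      using skew_selfadjoint_adjointI[OF adj] by auto
    then have "u = l *\<^sub>R p + A p" "p \<in> D" by auto
    then show "u \<in> R" by (auto simp: R_def)
  qed
  have "R = UNIV"
  proof (rule ccontr)
    assume "R \<noteq> UNIV"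
    then obtain z where z: "z \<noteq> 0" "\<And>v. v \<in> R \<Longrightarrow> v \<bullet> z = 0"
      using closed_subspace_proper_orthogonal[OF sub \<open>closed R\<close>] by metis
    \<comment> \<open>Orthogonality to the range, read as an adjoint identity, places
      \<open>z\<close> in the domain.\<close>
    have adj: "A v \<bullet> z = v \<bullet> (- (l *\<^sub>R z))" if "v \<in> D" for v
      using z(2)[of "l *\<^sub>R v + A v"] that by (auto simp: R_def inner_left_distrib)
    then have "z \<in> D" "A z = l *\<^sub>R z"
      using skew_selfadjoint_adjointI[OF adj] by auto
    then show False
      using skew_selfadjoint_inner_self[of z] l z(1) by simp
  qed
  then show ?thesis
    using that by (auto simp: R_def image_iff set_eq_iff) metis
qed

end

section \<open>Coercive systems with a skew-selfadjoint part\<close>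

text \<open>The power of \<open>H\<close> has a term as its exponent, so it is carried by
  extensional functions on \<open>I\<close>; fixing their values outside \<open>I\<close> is what
  lets \<open>d\<close> separate points. Positive weights make convergence in \<open>d\<close> the
  same as convergence of each component.\<close>

lemma weighted_product_complete:
  fixes W :: "'i \<Rightarrow> real"
  assumes I: "finite I" and W: "\<And>i. i \<in> I \<Longrightarrow> W i > 0"
  defines "X \<equiv> (PiE I (\<lambda>_. UNIV) :: ('i \<Rightarrow> 'h::{real_normed_vector, complete_space}) set)"
    and "d \<equiv> \<lambda>f g. sqrt (\<Sum>i\<in>I. W i * (norm (f i - g i))\<^sup>2)"
  shows "Metric_space X d" "Metric_space.mcomplete X d"
proof -
  \<comment> \<open>Moving the root of the weight into each component turns \<open>d\<close> into an
    \<open>L2_set\<close>, so that Minkowski's inequality gives the triangle inequality.\<close>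
  have d_L2: "d f g = L2_set (\<lambda>i. sqrt (W i) * norm (f i - g i)) I" for f g
    unfolding d_def L2_set_def
    by (intro arg_cong[of _ _ sqrt] sum.cong) (use W in \<open>auto simp: power_mult_distrib less_imp_le\<close>)
  show ms: "Metric_space X d"
  proof
    fix f g h
    show "0 \<le> d f g" by (simp add: d_L2)
    show "d f g = d g f" by (simp add: d_def norm_minus_commute)
    show "d f g = 0 \<longleftrightarrow> f = g" if "f \<in> X" "g \<in> X"
    proof
      assume "d f g = 0"
      then have "\<forall>i\<in>I. sqrt (W i) * norm (f i - g i) = 0"
        unfolding d_L2 by (subst (asm) L2_set_eq_0_iff) (use I in auto)
      then have "\<forall>i\<in>I. f i = g i"
        using W by fastforce
      then show "f = g"
        using that by (auto simp: X_def intro: PiE_ext)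
    qed (simp add: d_def)
    have "d f h \<le> L2_set (\<lambda>i. sqrt (W i) * norm (f i - g i) + sqrt (W i) * norm (g i - h i)) I"
      unfolding d_L2
    proof (rule L2_set_mono)
      fix i assume i: "i \<in> I"
      have "norm (f i - h i) \<le> norm (f i - g i) + norm (g i - h i)"
        using norm_triangle_ineq[of "f i - g i" "g i - h i"] by simp
      then have "sqrt (W i) * norm (f i - h i) \<le> sqrt (W i) * (norm (f i - g i) + norm (g i - h i))"
        using W[OF i] by (intro mult_left_mono) auto
      then show "sqrt (W i) * norm (f i - h i)
          \<le> sqrt (W i) * norm (f i - g i) + sqrt (W i) * norm (g i - h i)"
        by (simp add: distrib_left)
      show "0 \<le> sqrt (W i) * norm (f i - h i)"
        using W[OF i] by auto
    qed
    also have "\<dots> \<le> d f g + d g h"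
      unfolding d_L2 by (rule L2_set_triangle_ineq)
    finally show "d f h \<le> d f g + d g h" .
  qed
  interpret Metric_space X d by (rule ms)
  show mcomplete
    unfolding mcomplete_def
  proof (intro allI impI)
    fix s assume s: "MCauchy s"
    have coord: "sqrt (W i) * dist (f i) (g i) \<le> d f g" if "i \<in> I" for i f g
      using member_le_L2_set[OF I that, of "\<lambda>i. sqrt (W i) * norm (f i - g i)"]
      by (simp add: d_L2 dist_norm)
    have "convergent (\<lambda>n. s n i)" if i: "i \<in> I" for i
    proof (rule Cauchy_convergent, rule metric_CauchyI)
      fix e :: real assume "e > 0"
      then have "sqrt (W i) * e > 0"
        using W[OF i] by simp
      then obtain N where "\<forall>m n. N \<le> m \<longrightarrow> N \<le> n \<longrightarrow> d (s m) (s n) < sqrt (W i) * e"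
        using s unfolding MCauchy_def by blast
      then have "\<forall>m\<ge>N. \<forall>n\<ge>N. sqrt (W i) * dist (s m i) (s n i) < sqrt (W i) * e"
        using coord[OF i] by (meson le_less_trans)
      then show "\<exists>N. \<forall>m\<ge>N. \<forall>n\<ge>N. dist (s m i) (s n i) < e"
        using W[OF i] by auto
    qed
    then obtain l where l: "\<And>i. i \<in> I \<Longrightarrow> (\<lambda>n. s n i) \<longlonglongrightarrow> l i"
      unfolding convergent_def by metis
    have "(\<lambda>n. sqrt (\<Sum>i\<in>I. W i * (norm (s n i - restrict l I i))\<^sup>2))
        \<longlonglongrightarrow> sqrt (\<Sum>i\<in>I. W i * (norm (l i - l i))\<^sup>2)"
      by (intro tendsto_intros) (auto intro: l)
    then have lim: "(\<lambda>n. d (s n) (restrict l I)) \<longlonglongrightarrow> 0"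
      by (simp add: d_def)
    have "limitin mtopology s (restrict l I) sequentially"
      unfolding limit_metric_sequentially
    proof (intro conjI allI impI)
      show "restrict l I \<in> X" by (simp add: X_def)
      fix e :: real assume "e > 0"
      then obtain N where "\<forall>n\<ge>N. norm (d (s n) (restrict l I) - 0) < e"
        using LIMSEQ_D[OF lim] by blast
      moreover have "\<forall>n. s n \<in> X"
        using s unfolding MCauchy_def by blast
      ultimately show "\<exists>N. \<forall>n\<ge>N. s n \<in> X \<and> d (s n) (restrict l I) < e"
        by (auto intro!: exI[of _ N])
    qed
    then show "\<exists>l. limitin mtopology s l sequentially" by blast
  qed
qed

lemma bounded_linear_system_bound:
  fixes L :: "'i \<Rightarrow> 'i \<Rightarrow> 'h::real_normed_vector \<Rightarrow> 'h" and W :: "'i \<Rightarrow> real"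
  assumes I: "finite I" and W: "\<And>i. i \<in> I \<Longrightarrow> W i > 0"
    and L: "\<And>i j. i \<in> I \<Longrightarrow> j \<in> I \<Longrightarrow> bounded_linear (L i j)"
  obtains K where "K \<ge> 0"
    "\<And>V. (\<Sum>i\<in>I. W i * (norm (\<Sum>j\<in>I. L i j (V j)))\<^sup>2) \<le> K * (\<Sum>i\<in>I. W i * (norm (V i))\<^sup>2)"
proof -
  \<comment> \<open>Each \<open>norm (V j)\<close> is at most the weighted norm of \<open>V\<close>
    over \<open>sqrt (W j)\<close>, so \<open>e i\<close> bounds row \<open>i\<close> as an operator
    from the weighted norm to the norm of \<open>H\<close>.\<close>
  define e where "e i = (\<Sum>j\<in>I. onorm (L i j) / sqrt (W j))" for i
  show ?thesis
  proof (rule that[of "\<Sum>i\<in>I. W i * (e i)\<^sup>2"])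
    show "0 \<le> (\<Sum>i\<in>I. W i * (e i)\<^sup>2)"
      using W by (intro sum_nonneg mult_nonneg_nonneg) (auto intro: less_imp_le)
    fix V :: "'i \<Rightarrow> 'h"
    define N where "N = (\<Sum>i\<in>I. W i * (norm (V i))\<^sup>2)"
    have N0: "N \<ge> 0"
      unfolding N_def using W by (intro sum_nonneg mult_nonneg_nonneg) (auto intro: less_imp_le)
    have coord: "norm (V j) \<le> sqrt N / sqrt (W j)" if j: "j \<in> I" for j
    proof -
      have "W j * (norm (V j))\<^sup>2 \<le> N"
        unfolding N_def using I j W
        by (intro member_le_sum) (auto intro!: mult_nonneg_nonneg intro: less_imp_le)
      then have "(norm (V j))\<^sup>2 \<le> N / W j"
        using W[OF j] by (simp add: field_simps)
      then show ?thesis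
        using real_le_rsqrt real_sqrt_divide by metis
    qed
    have "W i * (norm (\<Sum>j\<in>I. L i j (V j)))\<^sup>2 \<le> W i * (e i)\<^sup>2 * N" if i: "i \<in> I" for i
    proof -
      have "norm (\<Sum>j\<in>I. L i j (V j)) \<le> (\<Sum>j\<in>I. norm (L i j (V j)))"
        by (rule norm_sum)
      also have "\<dots> \<le> (\<Sum>j\<in>I. onorm (L i j) * (sqrt N / sqrt (W j)))"
      proof (rule sum_mono)
        fix j assume j: "j \<in> I"
        have "norm (L i j (V j)) \<le> onorm (L i j) * norm (V j)"
          by (rule onorm[OF L[OF i j]])
        also have "\<dots> \<le> onorm (L i j) * (sqrt N / sqrt (W j))"
          using coord[OF j] onorm_pos_le[OF L[OF i j]] by (rule mult_left_mono)
        finally show "norm (L i j (V j)) \<le> onorm (L i j) * (sqrt N / sqrt (W j))" .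
      qed
      also have "\<dots> = e i * sqrt N"
        by (simp add: e_def sum_distrib_right)
      finally have "(norm (\<Sum>j\<in>I. L i j (V j)))\<^sup>2 \<le> (e i * sqrt N)\<^sup>2"
        by (rule power_mono) simp
      then show ?thesis
        using W[OF i] N0 by (simp add: power_mult_distrib mult.assoc)
    qed
    then show "(\<Sum>i\<in>I. W i * (norm (\<Sum>j\<in>I. L i j (V j)))\<^sup>2)
        \<le> (\<Sum>i\<in>I. W i * (e i)\<^sup>2) * (\<Sum>i\<in>I. W i * (norm (V i))\<^sup>2)"
      unfolding N_def[symmetric] sum_distrib_right by (rule sum_mono)
  qed
qed

text \<open>
  With \<open>B\<close> the bounded coercive part and \<open>l\<close> large, \<open>V \<mapsto> (l + A)\<^sup>-\<^sup>1 (G + l V - B V)\<close> is a contraction: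
  \<open>(l + A)\<^sup>-\<^sup>1\<close> has norm at most \<open>1 / l\<close> and
  \<open>\<parallel>l V - B V\<parallel>\<^sup>2 \<le> (l\<^sup>2 - 2 l c + K) \<parallel>V\<parallel>\<^sup>2\<close> where \<open>\<parallel>B V\<parallel>\<^sup>2 \<le> K \<parallel>V\<parallel>\<^sup>2\<close>.
\<close>

lemma coercive_plus_skew_onto:
  fixes L :: "'i \<Rightarrow> 'i \<Rightarrow> 'h::{real_inner, complete_space} \<Rightarrow> 'h" and W :: "'i \<Rightarrow> real"
  assumes skew: "skew_selfadjoint D A"
    and I: "finite I" and W: "\<And>i. i \<in> I \<Longrightarrow> W i > 0"
    and L: "\<And>i j. i \<in> I \<Longrightarrow> j \<in> I \<Longrightarrow> bounded_linear (L i j)"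
    and c: "c > 0"
    and coercive: "\<And>V. c * (\<Sum>i\<in>I. W i * (norm (V i))\<^sup>2)
        \<le> (\<Sum>i\<in>I. W i * ((\<Sum>j\<in>I. L i j (V j)) \<bullet> V i))"
  obtains V where "\<And>i. i \<in> I \<Longrightarrow> V i \<in> D"
    "\<And>i. i \<in> I \<Longrightarrow> (\<Sum>j\<in>I. L i j (V j)) + A (V i) = G i"
proof -
  define B where "B V i = (\<Sum>j\<in>I. L i j (V j))" for V i
  define N where "N V = (\<Sum>i\<in>I. W i * (norm (V i))\<^sup>2)" for V :: "'i \<Rightarrow> 'h"
  obtain K where K: "K \<ge> 0" and bound: "\<And>V. N (B V) \<le> K * N V"
    using bounded_linear_system_bound[of I W L, OF I W L] unfolding B_def N_def by blast
  have N0: "N V \<ge> 0" for V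
    unfolding N_def using W by (intro sum_nonneg mult_nonneg_nonneg) (auto intro: less_imp_le)
  have B_diff: "B (\<lambda>j. f j - g j) i = B f i - B g i" if "i \<in> I" for f g i
    unfolding B_def sum_subtractf[symmetric]
    by (intro sum.cong refl) (simp add: L that bounded_linear.linear linear_diff)
  \<comment> \<open>Any \<open>l\<close> with \<open>2 * l * c > K\<close> makes the contraction
    constant \<open>k\<close> less than 1, and \<open>l \<ge> 2 * c\<close> makes it nonnegative;
    the two summands secure one condition each.\<close>
  define l where "l = (K + 1) / c + 2 * c"
  have l: "l > 0" "l * c > K" "l \<ge> 2 * c"
    using K c by (auto simp: l_def field_simps intro!: add_pos_pos add_nonneg_pos)
  define k where "k = (l\<^sup>2 - 2 * l * c + K) / l\<^sup>2"
  have k: "0 \<le> k" "k < 1"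
  proof -
    have "0 \<le> l * (l - 2 * c) + K"
      using l K by (intro add_nonneg_nonneg mult_nonneg_nonneg) auto
    then show "0 \<le> k"
      by (auto simp: k_def power2_eq_square algebra_simps)
    show "k < 1"
      using l K by (auto simp: k_def field_simps)
  qed
  have "\<forall>y. \<exists>v\<in>D. l *\<^sub>R v + A v = y"
    using skew_selfadjoint_resolvent_onto[OF skew l(1)] by metis
  then obtain J where J: "\<And>y. J y \<in> D" "\<And>y. l *\<^sub>R J y + A (J y) = y"
    by metis
  have J_lip: "l * norm (J y - J z) \<le> norm (y - z)" for y z
  proof -
    have "l *\<^sub>R (J y - J z) + A (J y - J z) = (l *\<^sub>R J y + A (J y)) - (l *\<^sub>R J z + A (J z))"
      by (simp add: skew_selfadjoint_diff[OF skew] J(1) scaleR_diff_right)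
    then show ?thesis
      using skew_selfadjoint_resolvent_bound[OF skew _ l(1), of "J y - J z"]
        subspace_diff[OF skew_selfadjoint_domain(1)[OF skew]] J by metis
  qed
  \<comment> \<open>Solving \<open>(l + A) f = G + l f - B f\<close> for the left \<open>f\<close>;
    a fixed point solves the system since \<open>l f\<close> cancels. The restriction keeps iterates
    extensional.\<close>
  define \<Psi> where "\<Psi> f = restrict (\<lambda>i. J (G i + l *\<^sub>R f i - B f i)) I" for f
  have contr: "N (\<lambda>i. \<Psi> f i - \<Psi> g i) \<le> k * N (\<lambda>i. f i - g i)" for f g
  proof -
    define h where "h = (\<lambda>i. f i - g i)"
    have "l\<^sup>2 * N (\<lambda>i. \<Psi> f i - \<Psi> g i) = (\<Sum>i\<in>I. W i * (l * norm (\<Psi> f i - \<Psi> g i))\<^sup>2)"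
      unfolding N_def sum_distrib_left by (intro sum.cong) (auto simp: power_mult_distrib)
    also have "\<dots> \<le> (\<Sum>i\<in>I. W i * (norm (l *\<^sub>R h i - B h i))\<^sup>2)"
    proof (rule sum_mono)
      fix i assume i: "i \<in> I"
      have "l * norm (\<Psi> f i - \<Psi> g i) \<le> norm (l *\<^sub>R h i - B h i)"
        using J_lip[of "G i + l *\<^sub>R f i - B f i" "G i + l *\<^sub>R g i - B g i"] i
        by (simp add: \<Psi>_def B_diff h_def algebra_simps)
      then show "W i * (l * norm (\<Psi> f i - \<Psi> g i))\<^sup>2 \<le> W i * (norm (l *\<^sub>R h i - B h i))\<^sup>2"
        using l W[OF i] by (intro mult_left_mono power_mono) auto
    qed
    also have "\<dots> = l\<^sup>2 * N h - 2 * l * (\<Sum>i\<in>I. W i * (B h i \<bullet> h i)) + N (B h)"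
    proof -
      have sq: "(norm (l *\<^sub>R u - v))\<^sup>2 = l\<^sup>2 * (norm u)\<^sup>2 - 2 * l * (v \<bullet> u) + (norm v)\<^sup>2" for u v :: 'h
        unfolding power2_norm_eq_inner
        by (simp add: inner_diff_left inner_diff_right inner_commute power2_eq_square
            algebra_simps del: dot_square_norm)
      show ?thesis
        unfolding N_def sum_distrib_left sum_subtractf[symmetric] sum.distrib[symmetric] sq
        by (intro sum.cong refl) (simp add: algebra_simps)
    qed
    also have "\<dots> \<le> l\<^sup>2 * N h - 2 * l * (c * N h) + K * N h"
      using coercive[of h] bound[of h] l(1)
      by (intro add_mono diff_mono mult_left_mono) (auto simp: B_def N_def)
    also have "\<dots> = l\<^sup>2 * (k * N h)"
    proof -
      have "l\<^sup>2 * k = l\<^sup>2 - 2 * l * c + K"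
        using l by (simp add: k_def)
      then show ?thesis
        by (metis (no_types, lifting) left_diff_distrib distrib_right mult.assoc)
    qed
    finally show ?thesis
      using l by (simp add: h_def)
  qed
  define X where "X = (PiE I (\<lambda>_. UNIV) :: ('i \<Rightarrow> 'h) set)"
  define d where "d f g = sqrt (N (\<lambda>i. f i - g i))" for f g :: "'i \<Rightarrow> 'h"
  have ms: "Metric_space X d" "Metric_space.mcomplete X d"
    using weighted_product_complete[of I W, OF I W] unfolding X_def d_def N_def by blast+
  interpret Metric_space X d by (rule ms)
  obtain f where f: "\<Psi> f = f"
  \<comment> \<open>The estimate \<open>contr\<close> concerns squared distances, hence the constant
    \<open>sqrt k\<close>.\<close>
  proof (rule Banach_fixedpoint_thm[OF ms(2), of \<Psi> "sqrt k"])
    show "X \<noteq> {}" by (simp add: X_def PiE_eq_empty_iff)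
    show "\<Psi> \<in> X \<rightarrow> X" by (auto simp: \<Psi>_def X_def)
    show "sqrt k < 1" using k by simp
    show "d (\<Psi> f) (\<Psi> g) \<le> sqrt k * d f g" for f g
      unfolding d_def real_sqrt_mult[symmetric] using contr by (rule real_sqrt_le_mono)
  qed auto
  show ?thesis
  proof
    fix i assume i: "i \<in> I"
    have fi: "f i = J (G i + l *\<^sub>R f i - B f i)"
      using fun_cong[OF f, of i] i by (simp add: \<Psi>_def)
    then show "f i \<in> D"
      using J(1) by metis
    have "l *\<^sub>R f i + A (f i) = G i + l *\<^sub>R f i - B f i"
      using J(2)[of "G i + l *\<^sub>R f i - B f i"] unfolding fi[symmetric] .
    then show "(\<Sum>j\<in>I. L i j (f j)) + A (f i) = G i"
      by (simp add: B_def algebra_simps)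
  qed
qed

section \<open>Interpolation and Gauss--Radau quadrature\<close>

definition lagrange :: "(nat \<Rightarrow> real) \<Rightarrow> nat \<Rightarrow> nat \<Rightarrow> real poly" where
  "lagrange n q i = (\<Prod>j\<in>{..q} - {i}. smult (inverse (n i - n j)) [:- n j, 1:])"

lemma degree_lagrange: "i \<le> q \<Longrightarrow> degree (lagrange n q i) \<le> q"
proof -
  assume i: "i \<le> q"
  have "degree (lagrange n q i)
      \<le> sum (degree \<circ> (\<lambda>j. smult (inverse (n i - n j)) [:- n j, 1:])) ({..q} - {i})"
    unfolding lagrange_def by (rule degree_prod_sum_le) simp
  also have "\<dots> \<le> sum (\<lambda>_. 1) ({..q} - {i})"
    by (rule sum_mono) (simp add: degree_smult_eq)
  also have "\<dots> = q"
    using i by simp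
  finally show ?thesis .
qed

lemma poly_lagrange_node:
  assumes "inj_on n {..q}" "i \<le> q" "k \<le> q"
  shows "poly (lagrange n q i) (n k) = (if k = i then 1 else 0)"
proof (cases "k = i")
  case True
  have "poly (lagrange n q i) (n i) = (\<Prod>j\<in>{..q} - {i}. 1)"
    unfolding lagrange_def poly_prod
  proof (rule prod.cong[OF refl])
    fix j assume "j \<in> {..q} - {i}"
    then have "n i \<noteq> n j"
      using inj_onD[OF assms(1), of i j] assms(2) by auto
    then have "inverse (n i - n j) * (n i - n j) = 1"
      by simp
    then show "poly (smult (inverse (n i - n j)) [:- n j, 1:]) (n i) = 1"
      by (simp add: algebra_simps)
  qed
  then show ?thesis using True by simp
next
  case False
  then have "k \<in> {..q} - {i}" using assms(3) by simp
  then have "poly (lagrange n q i) (n k) = 0"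
    unfolding lagrange_def poly_prod by (intro prod_zero bexI[of _ k]) auto
  then show ?thesis using False by simp
qed

lemma lagrange_interpolation:
  assumes n: "inj_on n {..q}" and p: "degree p \<le> q"
  shows "(\<Sum>i\<le>q. smult (poly p (n i)) (lagrange n q i)) = p"
proof (rule poly_eqI_degree[of "n ` {..q}"])
  have c: "card (n ` {..q}) = Suc q"
    using card_image[OF n] by simp
  show "card (n ` {..q}) > degree p"
    using c p by simp
  have "degree (\<Sum>i\<le>q. smult (poly p (n i)) (lagrange n q i)) \<le> q"
    by (intro degree_sum_le order_trans[OF degree_smult_le degree_lagrange]) auto
  then show "card (n ` {..q}) > degree (\<Sum>i\<le>q. smult (poly p (n i)) (lagrange n q i))"
    using c by simp
  fix x assume "x \<in> n ` {..q}"
  then obtain k where k: "k \<le> q" "x = n k" by auto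
  have "poly (\<Sum>i\<le>q. smult (poly p (n i)) (lagrange n q i)) x
      = (\<Sum>i\<le>q. if k = i then poly p (n i) else 0)"
    unfolding poly_sum k(2) by (intro sum.cong) (auto simp: poly_lagrange_node[OF n _ k(1)])
  also have "\<dots> = poly p x"
    using k by simp
  finally show "poly (\<Sum>i\<le>q. smult (poly p (n i)) (lagrange n q i)) x = poly p x" .
qed

definition interp :: "(nat \<Rightarrow> real) \<Rightarrow> nat \<Rightarrow> (nat \<Rightarrow> 'h::real_vector) \<Rightarrow> real \<Rightarrow> 'h" where
  "interp n q V s = (\<Sum>i\<le>q. poly (lagrange n q i) s *\<^sub>R V i)"

definition interp_deriv :: "(nat \<Rightarrow> real) \<Rightarrow> nat \<Rightarrow> (nat \<Rightarrow> 'h::real_vector) \<Rightarrow> real \<Rightarrow> 'h" where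
  "interp_deriv n q V s = (\<Sum>i\<le>q. poly (pderiv (lagrange n q i)) s *\<^sub>R V i)"

lemma interp_diff: "interp n q (\<lambda>i. V i - V' i) s = interp n q V s - interp n q V' s"
  by (simp add: interp_def scaleR_diff_right sum_subtractf)

lemma interp_deriv_diff:
  "interp_deriv n q (\<lambda>i. V i - V' i) s = interp_deriv n q V s - interp_deriv n q V' s"
  by (simp add: interp_deriv_def scaleR_diff_right sum_subtractf)

lemma interp_node:
  assumes "inj_on n {..q}" "k \<le> q"
  shows "interp n q V (n k) = V k"
proof -
  have "interp n q V (n k) = (\<Sum>i\<le>q. if k = i then V i else 0)"
    unfolding interp_def by (intro sum.cong) (auto simp: poly_lagrange_node assms)
  then show ?thesis using assms(2) by simp
qed

lemma poly_on_interp: "poly_on q S (interp n q V)"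
proof -
  have "interp n q V s = (\<Sum>k\<le>q. s ^ k *\<^sub>R (\<Sum>i\<le>q. coeff (lagrange n q i) k *\<^sub>R V i))" for s
  proof -
    have "poly (lagrange n q i) s = (\<Sum>k\<le>q. coeff (lagrange n q i) k * s ^ k)" if "i \<le> q" for i
      unfolding poly_altdef using degree_lagrange[OF that, of n]
      by (intro sum.mono_neutral_left) (auto simp: coeff_eq_0)
    then have "interp n q V s = (\<Sum>i\<le>q. \<Sum>k\<le>q. (coeff (lagrange n q i) k * s ^ k) *\<^sub>R V i)"
      unfolding interp_def by (simp add: scaleR_sum_left)
    then show ?thesis
      by (subst (asm) sum.swap) (simp add: scaleR_sum_right mult.commute)
  qed
  then show ?thesis
    unfolding poly_on_def
    by (intro exI[of _ "\<lambda>k. \<Sum>i\<le>q. coeff (lagrange n q i) k *\<^sub>R V i"] ballI)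
qed

text \<open>Scalar interpolation reproduces every power up to \<open>q\<close>; multiplying by the
  vector coefficients and swapping the sums transfers this to \<open>u\<close>.\<close>

lemma poly_on_eq_interp:
  assumes u: "poly_on q S u" and n: "inj_on n {..q}" "\<And>i. i \<le> q \<Longrightarrow> n i \<in> S" and s: "s \<in> S"
  shows "u s = interp n q (\<lambda>i. u (n i)) s"
proof -
  obtain c where c: "\<And>s. s \<in> S \<Longrightarrow> u s = (\<Sum>k\<le>q. s ^ k *\<^sub>R c k)"
    using u unfolding poly_on_def by blast
  have pow: "s ^ k = (\<Sum>i\<le>q. poly (lagrange n q i) s * n i ^ k)" if "k \<le> q" for k
    using arg_cong[OF lagrange_interpolation[OF n(1), of "monom 1 k"], of "\<lambda>p. poly p s"] that
    by (simp add: poly_sum poly_monom degree_monom_eq mult.commute)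
  have "interp n q (\<lambda>i. u (n i)) s
      = (\<Sum>i\<le>q. \<Sum>k\<le>q. (poly (lagrange n q i) s * n i ^ k) *\<^sub>R c k)"
    unfolding interp_def by (intro sum.cong) (auto simp: c n(2) scaleR_sum_right)
  also have "\<dots> = (\<Sum>k\<le>q. s ^ k *\<^sub>R c k)"
    by (subst sum.swap) (simp add: pow scaleR_sum_left)
  also have "\<dots> = u s"
    using c[OF s] by simp
  finally show ?thesis ..
qed

lemma interp_has_vector_derivative:
  fixes V :: "nat \<Rightarrow> 'h::real_normed_vector"
  shows "(interp n q V has_vector_derivative interp_deriv n q V s) (at s within S)"
  unfolding interp_def interp_deriv_def
  by (intro has_vector_derivative_sum)
    (auto intro!: derivative_eq_intros has_vector_derivative_scaleR
      DERIV_subset[OF poly_DERIV])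

lemma continuous_interp:
  fixes V :: "nat \<Rightarrow> 'h::real_normed_vector"
  shows "isCont (interp n q V) s"
  by (rule has_vector_derivative_continuous[OF interp_has_vector_derivative])

lemma linear_interp:
  assumes "linear M"
  shows "M (interp n q V s) = interp n q (\<lambda>i. M (V i)) s"
    "M (interp_deriv n q V s) = interp_deriv n q (\<lambda>i. M (V i)) s"
  by (simp_all add: interp_def interp_deriv_def linear_sum[OF assms] linear_scale[OF assms])

section \<open>Nodes, weights and exactness of the Gauss-Radau rule\<close>

lemma gauss_radau_mono:
  assumes "gauss_radau \<sigma> q x w" "i < j" "j \<le> q"
  shows "x i < x j"
  using assms(2,3)
proof (induction j rule: less_induct)
  case (less j)
  then obtain k where k: "j = Suc k" by (cases j) auto
  have "x k < x j"
    using assms(1) less.prems k by (auto simp: gauss_radau_def)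
  then show ?case
    using less k by (cases "i = k") force+
qed

lemma gauss_radau_inj: "gauss_radau \<sigma> q x w \<Longrightarrow> inj_on x {..q}"
  by (rule inj_onI) (metis atMost_iff gauss_radau_mono less_irrefl linorder_neqE_nat)

lemma gauss_radau_node:
  assumes "gauss_radau \<sigma> q x w" "i \<le> q"
  shows "-1 < x i" "x i \<le> 1"
proof -
  have "-1 < x 0" "x q = 1"
    using assms(1) by (auto simp: gauss_radau_def)
  then show "-1 < x i" "x i \<le> 1"
    using gauss_radau_mono[OF assms(1), of 0 i] gauss_radau_mono[OF assms(1), of i q] assms(2)
    by (cases "i = 0"; cases "i = q"; force)+
qed

text \<open>Exactness applied to the square of the \<open>i\<close>-th Lagrange polynomial isolates the weight \<open>w i\<close>.\<close>

lemma gauss_radau_weight_pos: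
  assumes gr: "gauss_radau \<sigma> q x w" and i: "i \<le> q"
  shows "w i > 0"
proof -
  let ?l = "lagrange x q i"
  let ?f = "\<lambda>s. exp (- \<sigma> * (s + 1)) * poly (?l ^ 2) s"
  have "degree (?l ^ 2) \<le> 2 * q"
    using degree_power_le[of ?l 2] degree_lagrange[OF i, of x] by linarith
  then have int: "integral {-1..1} ?f = (\<Sum>j\<le>q. w j * poly (?l ^ 2) (x j))"
    using gr unfolding gauss_radau_def by blast
  also have "\<dots> = (\<Sum>j\<le>q. if j = i then w j else 0)"
    by (intro sum.cong) (auto simp: poly_lagrange_node[OF gauss_radau_inj[OF gr] i])
  also have "\<dots> = w i"
    using i by simp
  finally have w: "integral {-1..1} ?f = w i" .
  have cont: "continuous_on {-1..1} ?f"
    by (intro continuous_intros)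
  have nonneg: "?f s \<ge> 0" for s
    by simp
  have "integral {-1..1} ?f \<noteq> 0"
  proof
    assume "integral {-1..1} ?f = 0"
    then have "\<forall>s\<in>{-1..1}. ?f s = 0"
      by (subst (asm) integral_eq_0_iff[OF cont]) (use nonneg in auto)
    moreover have "x i \<in> {-1..1}"
      using gauss_radau_node[OF gr i] by simp
    ultimately have "poly ?l (x i) = 0"
      by fastforce
    then show False
      using poly_lagrange_node[OF gauss_radau_inj[OF gr] i i] by simp
  qed
  moreover have "integral {-1..1} ?f \<ge> 0"
    by (intro integral_nonneg integrable_continuous_real cont) (use nonneg in auto)
  ultimately show ?thesis
    using w by linarith
qed

text \<open>Integration by parts, which is exact under the quadrature since \<open>degree r \<le> 2 * q\<close>.\<close>

lemma gauss_radau_pderiv: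
  assumes gr: "gauss_radau \<sigma> q x w" and r: "degree r \<le> 2 * q"
  shows "(\<Sum>i\<le>q. w i * poly (pderiv r) (x i))
    = exp (- 2 * \<sigma>) * poly r 1 - poly r (-1) + \<sigma> * (\<Sum>i\<le>q. w i * poly r (x i))"
proof -
  \<comment> \<open>With this choice the weighted integrand is the exact derivative of
    \<open>exp (- \<sigma> * (s + 1)) * poly r s\<close>.\<close>
  let ?p = "pderiv r - smult \<sigma> r"
  have "degree ?p \<le> 2 * q"
    using r degree_pderiv[of r] by (intro degree_diff_le) (auto intro: order_trans[OF degree_smult_le])
  then have "integral {-1..1} (\<lambda>s. exp (- \<sigma> * (s + 1)) * poly ?p s) = (\<Sum>i\<le>q. w i * poly ?p (x i))"
    using gr unfolding gauss_radau_def by blast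
  moreover have "((\<lambda>s. exp (- \<sigma> * (s + 1)) * poly ?p s) has_integral
      exp (- \<sigma> * (1 + 1)) * poly r 1 - exp (- \<sigma> * (-1 + 1)) * poly r (-1)) {-1..1}"
  proof (rule fundamental_theorem_of_calculus)
    fix s :: real
    have "((\<lambda>s. exp (- \<sigma> * (s + 1)) * poly r s) has_real_derivative
        exp (- \<sigma> * (s + 1)) * poly ?p s) (at s)"
      by (auto intro!: derivative_eq_intros simp: algebra_simps)
    then show "((\<lambda>s. exp (- \<sigma> * (s + 1)) * poly r s) has_vector_derivative
        exp (- \<sigma> * (s + 1)) * poly ?p s) (at s within {-1..1})"
      unfolding has_real_derivative_iff_has_vector_derivative
      by (rule has_vector_derivative_at_within)
  qed simp
  ultimately have "(\<Sum>i\<le>q. w i * poly ?p (x i)) = exp (- 2 * \<sigma>) * poly r 1 - poly r (-1)"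
    by (simp add: integral_unique mult.commute)
  then show ?thesis
    by (simp add: algebra_simps sum_subtractf sum_distrib_left)
qed

section \<open>The problem on one slab\<close>

text \<open>The slab omits its left end, where \<open>u\<close> may take the value of another piece;
  the limit is the polynomial continued to \<open>a\<close>.\<close>

lemma right_limit_interp:
  fixes V :: "nat \<Rightarrow> 'h::real_normed_vector"
  assumes "a < b" "\<And>s. s \<in> {a<..b} \<Longrightarrow> u s = interp n q V s"
  shows "right_limit u a = interp n q V a"
  unfolding right_limit_def
proof (rule tendsto_Lim)
  have "(interp n q V \<longlongrightarrow> interp n q V a) (at_right a)"
    using continuous_interp[of a n q V] by (auto simp: isCont_def intro: tendsto_within_subset)
  moreover have "\<forall>\<^sub>F s in at_right a. interp n q V s = u s"
    unfolding eventually_at_right_field using assms by (auto intro!: exI[of _ b])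
  ultimately show "(u \<longlongrightarrow> interp n q V a) (at_right a)"
    by (rule Lim_transform_eventually)
qed simp

lemma left_limit_interp:
  fixes V :: "nat \<Rightarrow> 'h::real_normed_vector"
  assumes "a < b" "\<And>s. s \<in> {a<..b} \<Longrightarrow> u s = interp n q V s"
  shows "left_limit u b = u b"
proof -
  have "(interp n q V \<longlongrightarrow> interp n q V b) (at_left b)"
    using continuous_interp[of b n q V] by (auto simp: isCont_def intro: tendsto_within_subset)
  moreover have "\<forall>\<^sub>F s in at_left b. interp n q V s = u s"
    unfolding eventually_at_left_field using assms by (auto intro!: exI[of _ a])
  ultimately have "(u \<longlongrightarrow> interp n q V b) (at_left b)"
    by (rule Lim_transform_eventually)
  then show ?thesis
    unfolding left_limit_def using assms by (simp add: tendsto_Lim)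
qed

text \<open>One slab with the parameter \<rho> fixed. \<open>M0_nonneg\<close> has to be assumed
  separately here, since \<open>coercive\<close> at a single \<rho> does not imply it.\<close>

locale radau_slab =
  fixes M0 M1 A :: "'h::{real_inner, complete_space} \<Rightarrow> 'h"
    and D :: "'h set" and \<gamma> \<rho> a b :: real and q :: nat and x w :: "nat \<Rightarrow> real"
  assumes M0: "bounded_selfadjoint M0"
    and M1: "bounded_linear M1"
    and skew: "skew_selfadjoint D A"
    and \<gamma>: "\<gamma> > 0"
    and M0_nonneg: "M0 y \<bullet> y \<ge> 0"
    and coercive: "\<gamma> * (y \<bullet> y) \<le> (\<rho> *\<^sub>R M0 y + M1 y) \<bullet> y"
    and ab: "a < b"
    and gr: "gauss_radau (\<rho> * (b - a)) q x w"
begin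

definition node :: "nat \<Rightarrow> real" where
  "node i = (a + b) / 2 + (b - a) / 2 * x i"

definition weight :: "nat \<Rightarrow> real" where
  "weight i = (b - a) / 2 * w i"

lemma bounded_linear_M0: "bounded_linear M0"
  using M0 by (simp add: bounded_selfadjoint_def)

lemma linear_M0: "linear M0" and linear_M1: "linear M1"
  using bounded_linear_M0 M1 by (auto intro: bounded_linear.linear)

lemma M0_sym: "M0 y \<bullet> z = M0 z \<bullet> y"
  using M0 by (simp add: bounded_selfadjoint_def inner_commute)

lemma inj_node: "inj_on node {..q}"
  using gauss_radau_inj[OF gr] ab by (auto simp: node_def inj_on_def)

lemma node_in: "i \<le> q \<Longrightarrow> node i \<in> {a<..b}"
proof -
  assume i: "i \<le> q"
  have "(b - a) / 2 * (-1) < (b - a) / 2 * x i" "(b - a) / 2 * x i \<le> (b - a) / 2 * 1"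
    using gauss_radau_node[OF gr i] ab
    by (intro mult_strict_left_mono mult_left_mono; simp)+
  then show ?thesis
    unfolding node_def greaterThanAtMost_iff by argo
qed

lemma poly_on_eq_interp_node:
  assumes "poly_on q {a<..b} u" "s \<in> {a<..b}"
  shows "u s = interp node q (\<lambda>i. u (node i)) s"
  by (rule poly_on_eq_interp[OF assms(1) inj_node node_in assms(2)])

lemma weight_pos: "i \<le> q \<Longrightarrow> weight i > 0"
  using gauss_radau_weight_pos[OF gr] ab by (simp add: weight_def)

text \<open>Under the affine map onto the slab the reference weight becomes
  \<open>exp (- 2 * \<rho> * (s - a))\<close>, whence the factor 2 in front of \<rho>.\<close>

lemma quadrature_pderiv:
  assumes r: "degree r \<le> 2 * q"
  shows "(\<Sum>i\<le>q. weight i * poly (pderiv r) (node i))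
    = exp (- 2 * \<rho> * (b - a)) * poly r b - poly r a + 2 * \<rho> * (\<Sum>i\<le>q. weight i * poly r (node i))"
proof -
  let ?r = "pcompose r [:(a + b) / 2, (b - a) / 2:]"
  have "degree ?r \<le> 2 * q"
    using ab r by (simp add: degree_pcompose)
  from gauss_radau_pderiv[OF gr this]
  have "(\<Sum>i\<le>q. w i * (poly (pderiv r) (node i) * ((b - a) / 2)))
      = exp (- 2 * \<rho> * (b - a)) * poly r b - poly r a
        + \<rho> * (b - a) * (\<Sum>i\<le>q. w i * poly r (node i))"
    by (simp add: pderiv_pcompose poly_pcompose pderiv_pCons node_def field_simps)
  moreover have "(\<Sum>i\<le>q. w i * (poly (pderiv r) (node i) * ((b - a) / 2)))
      = (\<Sum>i\<le>q. weight i * poly (pderiv r) (node i))"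
    by (intro sum.cong) (auto simp: weight_def)
  moreover have "\<rho> * (b - a) * (\<Sum>i\<le>q. w i * poly r (node i))
      = 2 * \<rho> * (\<Sum>i\<le>q. weight i * poly r (node i))"
    unfolding sum_distrib_left by (intro sum.cong) (auto simp: weight_def)
  ultimately show ?thesis
    by linarith
qed

text \<open>Integration by parts leaves minus one half of the quadratic form of \<open>M0\<close> at
  \<open>a\<close>. The jump term contributes the whole form there, so a nonnegative half remains,
  besides the nonnegative term at \<open>b\<close>.\<close>

lemma M0_deriv_coercive:
  "\<rho> * (\<Sum>i\<le>q. weight i * (M0 (V i) \<bullet> V i))
    \<le> (\<Sum>i\<le>q. weight i * (M0 (interp_deriv node q V (node i)) \<bullet> V i))
      + M0 (interp node q V a) \<bullet> interp node q V a"
proof -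
  let ?P = "interp node q V" and ?P' = "interp_deriv node q V"
  \<comment> \<open>This is the function \<open>M0 (?P s) \<bullet> ?P s\<close> expanded as a real
    polynomial, so that its degree can be bounded; symmetry of \<open>M0\<close> gives the factor 2
    in its derivative.\<close>
  define r where "r = (\<Sum>i\<le>q. \<Sum>j\<le>q. smult (M0 (V i) \<bullet> V j) (lagrange node q i * lagrange node q j))"
  have deg: "degree r \<le> 2 * q"
    unfolding r_def
  proof (intro degree_sum_le)
    fix i j assume ij: "i \<in> {..q}" "j \<in> {..q}"
    have "degree (lagrange node q i * lagrange node q j) \<le> 2 * q"
      using degree_mult_le[of "lagrange node q i" "lagrange node q j"]
        degree_lagrange[of i q node] degree_lagrange[of j q node] ij by simp
    then show "degree (smult (M0 (V i) \<bullet> V j) (lagrange node q i * lagrange node q j)) \<le> 2 * q"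
      by (rule order_trans[OF degree_smult_le])
  qed auto
  have r: "poly r s = M0 (?P s) \<bullet> ?P s" for s
  proof -
    have "M0 (?P s) \<bullet> ?P s = (\<Sum>i\<le>q. \<Sum>j\<le>q.
        (poly (lagrange node q i) s *\<^sub>R M0 (V i)) \<bullet> (poly (lagrange node q j) s *\<^sub>R V j))"
      unfolding linear_interp(1)[OF linear_M0] unfolding interp_def
      unfolding inner_sum_left unfolding inner_sum_right ..
    then show ?thesis
      by (simp add: r_def poly_sum mult_ac)
  qed
  have r': "poly (pderiv r) s = 2 * (M0 (?P' s) \<bullet> ?P s)" for s
  proof (rule DERIV_unique)
    show "(poly r has_real_derivative poly (pderiv r) s) (at s)"
      by (rule poly_DERIV)
    have P: "(?P has_vector_derivative ?P' s) (at s)"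
      by (rule interp_has_vector_derivative)
    have "((\<lambda>s. M0 (?P s) \<bullet> ?P s) has_vector_derivative M0 (?P s) \<bullet> ?P' s + M0 (?P' s) \<bullet> ?P s) (at s)"
      by (rule bounded_bilinear.has_vector_derivative[OF bounded_bilinear_inner
          bounded_linear.has_vector_derivative[OF bounded_linear_M0 P] P])
    then show "(poly r has_real_derivative 2 * (M0 (?P' s) \<bullet> ?P s)) (at s)"
      unfolding has_real_derivative_iff_has_vector_derivative r[abs_def]
      using M0_sym[of "?P s" "?P' s"] by simp
  qed
  have "2 * (\<Sum>i\<le>q. weight i * (M0 (?P' (node i)) \<bullet> V i)) = (\<Sum>i\<le>q. weight i * poly (pderiv r) (node i))"
    unfolding sum_distrib_left r' by (intro sum.cong) (auto simp: interp_node[OF inj_node])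
  also have "\<dots> = exp (- 2 * \<rho> * (b - a)) * (M0 (?P b) \<bullet> ?P b) - M0 (?P a) \<bullet> ?P a
      + 2 * \<rho> * (\<Sum>i\<le>q. weight i * (M0 (V i) \<bullet> V i))"
    unfolding quadrature_pderiv[OF deg] r by (simp add: interp_node[OF inj_node])
  finally show ?thesis
    using M0_nonneg[of "?P a"] M0_nonneg[of "?P b"]
      mult_nonneg_nonneg[OF exp_ge_zero[of "- 2 * \<rho> * (b - a)"] M0_nonneg[of "?P b"]]
    by linarith
qed

text \<open>The pointwise bound is applied at every node, and \<open>M0_deriv_coercive\<close>
  trades its \<rho> term for the derivative and the trace at \<open>a\<close>.\<close>

lemma bounded_part_coercive:
  "\<gamma> * (\<Sum>i\<le>q. weight i * (norm (V i))\<^sup>2)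
    \<le> (\<Sum>i\<le>q. weight i * ((M0 (interp_deriv node q V (node i)) + M1 (V i)) \<bullet> V i))
      + M0 (interp node q V a) \<bullet> interp node q V a"
proof -
  have "\<gamma> * (\<Sum>i\<le>q. weight i * (norm (V i))\<^sup>2)
      \<le> (\<Sum>i\<le>q. weight i * ((\<rho> *\<^sub>R M0 (V i) + M1 (V i)) \<bullet> V i))"
    unfolding sum_distrib_left
  proof (rule sum_mono)
    fix i assume "i \<in> {..q}"
    then have "weight i * (\<gamma> * (V i \<bullet> V i)) \<le> weight i * ((\<rho> *\<^sub>R M0 (V i) + M1 (V i)) \<bullet> V i)"
      using weight_pos[of i] coercive[of "V i"] by (intro mult_left_mono) auto
    then show "\<gamma> * (weight i * (norm (V i))\<^sup>2) \<le> weight i * ((\<rho> *\<^sub>R M0 (V i) + M1 (V i)) \<bullet> V i)"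
      by (simp add: power2_norm_eq_inner mult.left_commute)
  qed
  also have "\<dots> = \<rho> * (\<Sum>i\<le>q. weight i * (M0 (V i) \<bullet> V i)) + (\<Sum>i\<le>q. weight i * (M1 (V i) \<bullet> V i))"
    by (simp add: inner_left_distrib sum.distrib sum_distrib_left algebra_simps)
  finally show ?thesis
    using M0_deriv_coercive[of V] by (simp add: inner_left_distrib sum.distrib distrib_left)
qed

text \<open>The slab equation in terms of the nodal values \<open>V\<close> of \<open>U\<close> and \<open>Z\<close> of \<open>\<Phi>\<close>.\<close>

definition slab_form :: "'h \<Rightarrow> (nat \<Rightarrow> 'h) \<Rightarrow> (nat \<Rightarrow> 'h) \<Rightarrow> real" where
  "slab_form g V Z =
     (\<Sum>i\<le>q. weight i * ((M0 (interp_deriv node q V (node i)) + M1 (V i) + A (V i)) \<bullet> Z i))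
     + M0 (interp node q V a - g) \<bullet> interp node q Z a"

text \<open>The form is affine in \<open>V\<close> and \<open>g\<close> enters only its constant
  term, so the difference of two solutions with equal incoming value solves the homogeneous
  problem.\<close>

lemma slab_form_diff:
  assumes "\<And>i. i \<le> q \<Longrightarrow> V i \<in> D" "\<And>i. i \<le> q \<Longrightarrow> V' i \<in> D"
  shows "slab_form 0 (\<lambda>i. V i - V' i) Z = slab_form g V Z - slab_form g V' Z"
proof -
  have "(\<Sum>i\<le>q. weight i * ((M0 (interp_deriv node q (\<lambda>i. V i - V' i) (node i))
        + M1 (V i - V' i) + A (V i - V' i)) \<bullet> Z i))
      = (\<Sum>i\<le>q. weight i * ((M0 (interp_deriv node q V (node i)) + M1 (V i) + A (V i)) \<bullet> Z i))
        - (\<Sum>i\<le>q. weight i * ((M0 (interp_deriv node q V' (node i)) + M1 (V' i) + A (V' i)) \<bullet> Z i))"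
    unfolding sum_subtractf[symmetric]
    by (intro sum.cong refl)
      (simp add: interp_deriv_diff linear_diff[OF linear_M0] linear_diff[OF linear_M1]
        skew_selfadjoint_diff[OF skew] assms algebra_simps)
  then show ?thesis
    by (simp add: slab_form_def interp_diff linear_diff[OF linear_M0] algebra_simps)
qed

lemma slab_form_zero:
  assumes D: "\<And>i. i \<le> q \<Longrightarrow> V i \<in> D" and zero: "slab_form 0 V V = 0" and i: "i \<le> q"
  shows "V i = 0"
proof -
  have nonneg: "0 \<le> weight i * (norm (V i))\<^sup>2" if "i \<le> q" for i
    using weight_pos[OF that] by simp
  have "(\<Sum>i\<le>q. weight i * ((M0 (interp_deriv node q V (node i)) + M1 (V i) + A (V i)) \<bullet> V i))
      = (\<Sum>i\<le>q. weight i * ((M0 (interp_deriv node q V (node i)) + M1 (V i)) \<bullet> V i))"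
    by (intro sum.cong refl)
      (simp add: inner_left_distrib skew_selfadjoint_inner_self[OF skew] D)
  then have "\<gamma> * (\<Sum>i\<le>q. weight i * (norm (V i))\<^sup>2) \<le> 0"
    using bounded_part_coercive[of V] zero unfolding slab_form_def by simp
  then have "(\<Sum>i\<le>q. weight i * (norm (V i))\<^sup>2) \<le> 0"
    using \<gamma> by (simp add: mult_le_0_iff)
  then have "(\<Sum>i\<le>q. weight i * (norm (V i))\<^sup>2) = 0"
    using nonneg by (intro antisym sum_nonneg) auto
  then have "weight i * (norm (V i))\<^sup>2 = 0"
    using nonneg i by (subst (asm) sum_nonneg_eq_0_iff) auto
  then show ?thesis
    using weight_pos[OF i] by simp
qed

text \<open>The trace of \<open>Z\<close> at \<open>a\<close> is a combination of nodal values, so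
  pairing it with \<open>M0 y\<close> equals a weighted nodal pairing with the vectors in
  \<open>trace\<close>. The variational equation thus becomes one equation in \<open>H\<close> per
  node.\<close>

lemma slab_form_solvable:
  obtains V where "\<And>i. i \<le> q \<Longrightarrow> V i \<in> D"
    "\<And>Z. slab_form g V Z = (\<Sum>i\<le>q. weight i * (f i \<bullet> Z i))"
proof -
  let ?l = "lagrange node q"
  \<comment> \<open>The summands are the derivative of \<open>M0 U\<close> at node \<open>i\<close>,
    the diagonal \<open>M1\<close>, and the trace of \<open>U\<close>. In the last,
    \<open>poly (?l j) a\<close> evaluates \<open>U\<close> at \<open>a\<close>, while
    \<open>poly (?l i) a / weight i\<close> represents testing there.\<close>
  define L where "L i j y = poly (pderiv (?l j)) (node i) *\<^sub>R M0 y + (if i = j then M1 y else 0)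
      + (poly (?l i) a * poly (?l j) a / weight i) *\<^sub>R M0 y" for i j y
  have "bounded_linear (\<lambda>y. if i = j then M1 y else 0)" for i j :: nat
    by (cases "i = j") (simp_all add: M1 bounded_linear_zero)
  then have L: "bounded_linear (L i j)" for i j
    unfolding L_def
    by (intro bounded_linear_add bounded_linear_compose[OF bounded_linear_scaleR_right bounded_linear_M0])
  have sum_L: "(\<Sum>j\<le>q. L i j (V j)) = M0 (interp_deriv node q V (node i)) + M1 (V i)
      + (poly (?l i) a / weight i) *\<^sub>R M0 (interp node q V a)" if "i \<le> q" for V i
    using that unfolding linear_interp[OF linear_M0]
    by (simp add: L_def interp_def interp_deriv_def sum.distrib scaleR_sum_right)
  have trace: "(\<Sum>i\<le>q. weight i * ((poly (?l i) a / weight i) *\<^sub>R M0 y \<bullet> Z i)) = M0 y \<bullet> interp node q Z a"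
    for y Z
    unfolding interp_def inner_sum_right
  proof (rule sum.cong[OF refl])
    fix i assume "i \<in> {..q}"
    then have "weight i \<noteq> 0"
      using weight_pos[of i] by simp
    then show "weight i * ((poly (?l i) a / weight i) *\<^sub>R M0 y \<bullet> Z i) = M0 y \<bullet> poly (?l i) a *\<^sub>R Z i"
      by simp
  qed
  have sum_L_inner: "(\<Sum>i\<le>q. weight i * ((\<Sum>j\<le>q. L i j (V j)) \<bullet> Z i))
      = (\<Sum>i\<le>q. weight i * ((M0 (interp_deriv node q V (node i)) + M1 (V i)) \<bullet> Z i))
        + M0 (interp node q V a) \<bullet> interp node q Z a" for V Z
    unfolding trace[symmetric] sum.distrib[symmetric]
    by (intro sum.cong refl) (simp add: sum_L inner_left_distrib distrib_left)
  obtain V where V: "\<And>i. i \<le> q \<Longrightarrow> V i \<in> D"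
    "\<And>i. i \<le> q \<Longrightarrow> (\<Sum>j\<le>q. L i j (V j)) + A (V i) = f i + (poly (?l i) a / weight i) *\<^sub>R M0 g"
  proof (rule coercive_plus_skew_onto[of D A "{..q}" weight L \<gamma>
        "\<lambda>i. f i + (poly (?l i) a / weight i) *\<^sub>R M0 g"])
    show "\<gamma> * (\<Sum>i\<le>q. weight i * (norm (V i))\<^sup>2)
        \<le> (\<Sum>i\<le>q. weight i * ((\<Sum>j\<le>q. L i j (V j)) \<bullet> V i))" for V
      unfolding sum_L_inner by (rule bounded_part_coercive)
  qed (use skew weight_pos L \<gamma> in auto)
  show ?thesis
  proof
    show "V i \<in> D" if "i \<le> q" for i by (rule V(1)[OF that])
    fix Z
    have "slab_form g V Z = (\<Sum>i\<le>q. weight i * ((\<Sum>j\<le>q. L i j (V j)) \<bullet> Z i))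
        + (\<Sum>i\<le>q. weight i * (A (V i) \<bullet> Z i)) - M0 g \<bullet> interp node q Z a"
      unfolding sum_L_inner slab_form_def
      by (simp add: inner_left_distrib distrib_left sum.distrib linear_diff[OF linear_M0] inner_diff_left)
    also have "\<dots> = (\<Sum>i\<le>q. weight i * (((\<Sum>j\<le>q. L i j (V j)) + A (V i)) \<bullet> Z i)) - M0 g \<bullet> interp node q Z a"
      by (simp add: inner_left_distrib distrib_left sum.distrib)
    also have "\<dots> = (\<Sum>i\<le>q. weight i * ((f i + (poly (?l i) a / weight i) *\<^sub>R M0 g) \<bullet> Z i)) - M0 g \<bullet> interp node q Z a"
      using V(2) by simp
    also have "\<dots> = (\<Sum>i\<le>q. weight i * (f i \<bullet> Z i))"
      unfolding trace[of g Z, symmetric] by (simp only: inner_left_distrib distrib_left sum.distrib)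
    finally show "slab_form g V Z = (\<Sum>i\<le>q. weight i * (f i \<bullet> Z i))" .
  qed
qed

text \<open>The incoming value \<open>g\<close> is a parameter so that the first slab, with the
  initial value, and the later ones, with a left limit, are the same problem.\<close>

definition slab_equation :: "'h \<Rightarrow> (real \<Rightarrow> 'h) \<Rightarrow> (real \<Rightarrow> 'h) \<Rightarrow> (real \<Rightarrow> 'h) \<Rightarrow> bool" where
  "slab_equation g F U \<Phi> \<longleftrightarrow>
     (\<Sum>i\<le>q. weight i * ((vector_derivative (\<lambda>r. M0 (U r)) (at (node i) within {a<..b})
        + M1 (U (node i)) + A (U (node i))) \<bullet> \<Phi> (node i)))
     + M0 (right_limit U a - g) \<bullet> right_limit \<Phi> a
     = (\<Sum>i\<le>q. weight i * (F (node i) \<bullet> \<Phi> (node i)))"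

lemma slab_equation_iff:
  assumes U: "poly_on q {a<..b} U" and \<Phi>: "poly_on q {a<..b} \<Phi>"
  shows "slab_equation g F U \<Phi> \<longleftrightarrow>
    slab_form g (\<lambda>i. U (node i)) (\<lambda>i. \<Phi> (node i)) = (\<Sum>i\<le>q. weight i * (F (node i) \<bullet> \<Phi> (node i)))"
proof -
  note U' = poly_on_eq_interp_node[OF U] and \<Phi>' = poly_on_eq_interp_node[OF \<Phi>]
  have "vector_derivative (\<lambda>r. M0 (U r)) (at (node i) within {a<..b})
      = M0 (interp_deriv node q (\<lambda>i. U (node i)) (node i))" if i: "i \<le> q" for i
  proof (rule vector_derivative_within)
    \<comment> \<open>The last node is \<open>b\<close>, where only points to the left are
      available; being a limit point of the slab is what makes the derivative unique.\<close>
    show "at (node i) within {a<..b} \<noteq> bot"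
      using node_in[OF i] ab
      by (auto simp: trivial_limit_within intro: islimpt_subset[OF islimpt_greaterThanLessThan2])
    show "((\<lambda>r. M0 (U r)) has_vector_derivative M0 (interp_deriv node q (\<lambda>i. U (node i)) (node i)))
        (at (node i) within {a<..b})"
      by (rule has_vector_derivative_transform[OF node_in[OF i] _ bounded_linear.has_vector_derivative[OF
              bounded_linear_M0 interp_has_vector_derivative]]) (simp add: U')
  qed
  then show ?thesis
    unfolding slab_equation_def slab_form_def
    using right_limit_interp[OF ab U'] right_limit_interp[OF ab \<Phi>'] by simp
qed

text \<open>The equation is asserted for every \<open>U\<close> that agrees with \<open>u\<close> on
  the slab, because the solution used later is glued from all slabs.\<close>

lemma slab_exists:
  obtains u where "poly_on q {a<..b} u" "\<And>s. u s \<in> D"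
    "\<And>U (\<Phi> :: real \<Rightarrow> 'h). (\<And>s. s \<in> {a<..b} \<Longrightarrow> U s = u s) \<Longrightarrow> poly_on q {a<..b} \<Phi> \<Longrightarrow> slab_equation g F U \<Phi>"
proof -
  obtain V where V: "\<And>i. i \<le> q \<Longrightarrow> V i \<in> D"
    "\<And>Z. slab_form g V Z = (\<Sum>i\<le>q. weight i * (F (node i) \<bullet> Z i))"
    using slab_form_solvable[of g "\<lambda>i. F (node i)"] by metis
  show ?thesis
  proof
    show "poly_on q {a<..b} (interp node q V)"
      by (rule poly_on_interp)
    show "interp node q V s \<in> D" for s
      unfolding interp_def
      by (intro subspace_sum subspace_scale skew_selfadjoint_domain(1)[OF skew]) (auto intro: V)
    fix U \<Phi> :: "real \<Rightarrow> 'h"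
    assume U: "\<And>s. s \<in> {a<..b} \<Longrightarrow> U s = interp node q V s" and \<Phi>: "poly_on q {a<..b} \<Phi>"
    have "poly_on q {a<..b} U"
      using poly_on_interp[of q "{a<..b}" node V] U unfolding poly_on_def by simp
    moreover have "slab_form g (\<lambda>i. U (node i)) Z = slab_form g V Z" for Z
      \<comment> \<open>Unfolding \<open>interp\<close> only at \<open>a\<close> leaves its values
        at the nodes to \<open>interp_node\<close>.\<close>
      using U[OF node_in] unfolding slab_form_def interp_def[of _ _ _ a] interp_deriv_def
      by (simp add: interp_node[OF inj_node])
    ultimately show "slab_equation g F U \<Phi>"
      using V(2) by (simp add: slab_equation_iff \<Phi>)
  qed
qed

text \<open>\<Phi> need equal the difference only on this slab, so one global test function can
  serve all slabs.\<close>

lemma slab_unique: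
  assumes U: "poly_on q {a<..b} U" "\<And>s. s \<in> {a<..b} \<Longrightarrow> U s \<in> D"
    and U': "poly_on q {a<..b} U'" "\<And>s. s \<in> {a<..b} \<Longrightarrow> U' s \<in> D"
    and \<Phi>: "poly_on q {a<..b} \<Phi>" "\<And>s. s \<in> {a<..b} \<Longrightarrow> \<Phi> s = U s - U' s"
    and eq: "slab_equation g F U \<Phi>" "slab_equation g F U' \<Phi>"
    and s: "s \<in> {a<..b}"
  shows "U s = U' s"
proof -
  define V where "V = (\<lambda>i. U (node i) - U' (node i))"
  have D: "U (node i) \<in> D" "U' (node i) \<in> D" if "i \<le> q" for i
    using U(2) U'(2) node_in[OF that] by blast+
  have "slab_form g (\<lambda>i. U (node i)) (\<lambda>i. \<Phi> (node i)) = slab_form g (\<lambda>i. U' (node i)) (\<lambda>i. \<Phi> (node i))"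
    using eq by (simp add: slab_equation_iff U U' \<Phi>(1))
  then have "slab_form 0 V (\<lambda>i. \<Phi> (node i)) = 0"
    using slab_form_diff[of "\<lambda>i. U (node i)" "\<lambda>i. U' (node i)" "\<lambda>i. \<Phi> (node i)" g]
    by (simp add: V_def D)
  then have "slab_form 0 V V = 0"
    using \<Phi>(2)[OF node_in] unfolding slab_form_def interp_def by (simp add: V_def)
  moreover have "V i \<in> D" if "i \<le> q" for i
    unfolding V_def using D[OF that] by (intro subspace_diff skew_selfadjoint_domain(1)[OF skew])
  ultimately have "V i = 0" if "i \<le> q" for i
    using slab_form_zero that by blast
  then have "interp node q (\<lambda>i. U (node i)) s = interp node q (\<lambda>i. U' (node i)) s"
    unfolding interp_def V_def by simp
  then show ?thesis
    using poly_on_eq_interp_node[OF U(1) s] poly_on_eq_interp_node[OF U'(1) s]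
    by simp
qed

lemma left_limit_slab:
  fixes u :: "real \<Rightarrow> 'h"
  assumes "poly_on q {a<..b} u"
  shows "left_limit u b = u b"
  by (rule left_limit_interp[OF ab poly_on_eq_interp_node[OF assms]])

end

section \<open>Composition of the slabs\<close>

lemma quad_inner_eq_sum:
  assumes "radau_slab M0 M1 A D \<gamma> \<rho> (t (m - 1)) (t m) q (x m) (w m)"
  shows "quad_inner t q x w m f \<Phi>
    = (\<Sum>i\<le>q. radau_slab.weight (t (m - 1)) (t m) (w m) i
        * (f (radau_slab.node (t (m - 1)) (t m) (x m) i) \<bullet> \<Phi> (radau_slab.node (t (m - 1)) (t m) (x m) i)))"
  unfolding quad_inner_def quad_def quad_node_def step_def sum_distrib_left
    radau_slab.weight_def[OF assms] radau_slab.node_def[OF assms] mult.assoc ..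

section \<open>Locating a time in the partition\<close>

lemma partition_strict_mono:
  assumes "is_partition T M t" "i < j" "j \<le> M"
  shows "t i < t j"
  using assms(2,3)
proof (induction j)
  case (Suc j)
  then have "t j < t (Suc j)"
    using assms(1) by (auto simp: is_partition_def)
  then show ?case
    using Suc by (cases "i = j") auto
qed simp

lemma partition_mono:
  assumes "is_partition T M t" "i \<le> j" "j \<le> M"
  shows "t i \<le> t j"
  using partition_strict_mono[OF assms(1), of i j] assms(2,3) by (cases "i = j") auto

lemma partition_slab_subset:
  assumes "is_partition T M t" "m \<in> {1..M}"
  shows "slab t m \<subseteq> {0<..T}"
proof -
  have "0 \<le> t (m - 1)" "t m \<le> T"
    using partition_mono[OF assms(1), of 0 "m - 1"] partition_mono[OF assms(1), of m M] assms
    by (auto simp: is_partition_def)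
  then show ?thesis
    by (auto simp: slab_def)
qed

definition slab_index :: "(nat \<Rightarrow> real) \<Rightarrow> real \<Rightarrow> nat" where
  "slab_index t s = (LEAST k. s \<le> t k)"

lemma slab_index_eq:
  assumes "is_partition T M t" "m \<in> {1..M}" "s \<in> slab t m"
  shows "slab_index t s = m"
  unfolding slab_index_def
proof (rule Least_equality)
  show "s \<le> t m"
    using assms(3) by (simp add: slab_def)
  fix k assume k: "s \<le> t k"
  show "m \<le> k"
  proof (rule ccontr)
    assume "\<not> m \<le> k"
    then have "t k \<le> t (m - 1)"
      using assms(2) by (intro partition_mono[OF assms(1)]) auto
    then show False
      using k assms(3) by (simp add: slab_def)
  qed
qed

lemma slab_index_slab:
  assumes "is_partition T M t" "s \<in> {0<..T}"
  shows "slab_index t s \<in> {1..M}" "s \<in> slab t (slab_index t s)"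
proof -
  have M: "s \<le> t M"
    using assms by (simp add: is_partition_def)
  have le: "s \<le> t (slab_index t s)"
    unfolding slab_index_def using M by (rule LeastI)
  have "slab_index t s \<le> M"
    unfolding slab_index_def using M by (rule Least_le)
  moreover have nz: "slab_index t s \<noteq> 0"
  proof
    assume "slab_index t s = 0"
    then show False
      using le assms by (simp add: is_partition_def)
  qed
  ultimately show "slab_index t s \<in> {1..M}" by simp
  have "\<not> s \<le> t (slab_index t s - 1)"
    using nz not_less_Least[of "slab_index t s - 1" "\<lambda>k. s \<le> t k"] by (simp add: slab_index_def)
  then show "s \<in> slab t (slab_index t s)"
    using le by (simp add: slab_def)
qed

text \<open>Divide the coercivity estimate by \<open>r\<close> and let \<open>r\<close> tend to infinity.\<close>

lemma coercive_family_nonneg: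
  fixes M0 M1 :: "'h::real_inner \<Rightarrow> 'h"
  assumes "\<gamma> > 0" "\<forall>r\<ge>\<rho>\<^sub>0. \<forall>y. (r *\<^sub>R M0 y + M1 y) \<bullet> y \<ge> \<gamma> * (y \<bullet> y)"
  shows "M0 y \<bullet> y \<ge> 0"
proof (rule ccontr)
  assume neg: "\<not> M0 y \<bullet> y \<ge> 0"
  \<comment> \<open>A value so large that a negative \<open>M0 y \<bullet> y\<close> would push the
    form at \<open>r\<close> down to at most -1, while coercivity keeps it nonnegative.\<close>
  define r where "r = max \<rho>\<^sub>0 ((M1 y \<bullet> y + 1) / - (M0 y \<bullet> y))"
  have "(M1 y \<bullet> y + 1) / - (M0 y \<bullet> y) \<le> r"
    by (simp add: r_def)
  then have "M1 y \<bullet> y + 1 \<le> r * - (M0 y \<bullet> y)"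
    using neg by (subst (asm) pos_divide_le_eq) auto
  moreover have "0 \<le> \<gamma> * (y \<bullet> y)"
    using assms(1) by simp
  moreover have "\<gamma> * (y \<bullet> y) \<le> r * (M0 y \<bullet> y) + M1 y \<bullet> y"
    using assms(2) by (simp add: r_def inner_left_distrib)
  ultimately show False
    by simp
qed

theorem proposition3p1:
  fixes M0 M1 A :: "'h::{real_inner, complete_space} \<Rightarrow> 'h"
    and D :: "'h set"
    and \<rho>\<^sub>0 \<gamma> \<rho> T :: real
    and q M :: nat
    and t :: "nat \<Rightarrow> real"
    and x w :: "nat \<Rightarrow> nat \<Rightarrow> real"
    and F :: "real \<Rightarrow> 'h"
    and x0 :: 'h
  assumes "bounded_selfadjoint M0"
    and "bounded_linear M1"
    and "skew_selfadjoint D A"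
    and "\<rho>\<^sub>0 > 0" and "\<gamma> > 0"
    and "\<forall>r\<ge>\<rho>\<^sub>0. \<forall>y. (r *\<^sub>R M0 y + M1 y) \<bullet> y \<ge> \<gamma> * (y \<bullet> y)"
    and "\<rho> \<ge> \<rho>\<^sub>0"
    and "T > 0"
    and "is_partition T M t"
    and "\<forall>m\<in>{1..M}. gauss_radau (\<rho> * step t m) q (x m) (w m)"
    and "F \<in> pw_poly_space T M t q"
  shows "\<exists>!U. U \<in> pw_poly_space T M t q \<and>
           (\<forall>m\<in>{1..M}. \<forall>s\<in>slab t m. U s \<in> D) \<and>
           (\<forall>\<Phi>\<in>pw_poly_space T M t q. \<forall>m\<in>{1..M}.
              quad_inner t q x w m
                (\<lambda>s. slab_deriv t m (\<lambda>r. M0 (U r)) s + M1 (U s) + A (U s)) \<Phi>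
              + M0 (jump t x0 U m) \<bullet> right_limit \<Phi> (t (m - 1))
              = quad_inner t q x w m F \<Phi>)"
proof -
  note part = assms(9)
  have slab_len: "t (m - 1) < t m" if "m \<in> {1..M}" for m
    using partition_strict_mono[OF part, of "m - 1" m] that by simp
  have slab: "radau_slab M0 M1 A D \<gamma> \<rho> (t (m - 1)) (t m) q (x m) (w m)" if "m \<in> {1..M}" for m
    by (rule radau_slab.intro)
      (use assms slab_len[OF that] that coercive_family_nonneg[OF assms(5,6)] in \<open>auto simp: step_def\<close>)
  define prev where "prev U m = (if m = 1 then x0 else left_limit U (t (m - 1)))"
    for U :: "real \<Rightarrow> 'h" and m
  define eqn where "eqn m g = radau_slab.slab_equation M0 M1 A (t (m - 1)) (t m) q (x m) (w m) g F"
    for m g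
  have eqn: "quad_inner t q x w m
          (\<lambda>s. slab_deriv t m (\<lambda>r. M0 (U r)) s + M1 (U s) + A (U s)) \<Phi>
        + M0 (jump t x0 U m) \<bullet> right_limit \<Phi> (t (m - 1))
        = quad_inner t q x w m F \<Phi> \<longleftrightarrow> eqn m (prev U m) U \<Phi>" if "m \<in> {1..M}" for U \<Phi> m
    unfolding quad_inner_eq_sum[where t = t and m = m and x = x and w = w, OF slab[OF that]]
      eqn_def radau_slab.slab_equation_def[OF slab[OF that]] slab_deriv_def slab_def jump_def prev_def ..
  \<comment> \<open>Slabs contain their right end, so the left limit is the value of the preceding
    piece there.\<close>
  have prev_eq: "prev U m = U (t (m - 1))"
    if "m \<in> {1..M}" "m \<noteq> 1" "poly_on q (slab t (m - 1)) U" for U m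
  proof -
    have "m - 1 \<in> {1..M}"
      using that(1,2) by auto
    then show ?thesis
      using radau_slab.left_limit_slab[OF slab, of "m - 1" U] that(2,3) by (simp add: prev_def slab_def)
  qed

  \<comment> \<open>Solvability for every incoming value, so that choice yields solution maps
    \<open>P m\<close> that can be chained.\<close>
  have "\<forall>m\<in>{1..M}. \<forall>g. \<exists>u. poly_on q (slab t m) u \<and> (\<forall>s. u s \<in> D) \<and>
      (\<forall>U \<Phi>. (\<forall>s\<in>slab t m. U s = u s) \<longrightarrow> poly_on q (slab t m) \<Phi> \<longrightarrow> eqn m g U \<Phi>)"
  proof (intro ballI allI)
    fix m g assume m: "m \<in> {1..M}"
    obtain u where u: "poly_on q (slab t m) u" "\<And>s. u s \<in> D"
      "\<And>U \<Phi>. (\<And>s. s \<in> slab t m \<Longrightarrow> U s = u s) \<Longrightarrow> poly_on q (slab t m) \<Phi> \<Longrightarrow> eqn m g U \<Phi>"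
      unfolding slab_def eqn_def
      by (rule radau_slab.slab_exists[OF slab[OF m], where g = g and F = F]) blast
    show "\<exists>u. poly_on q (slab t m) u \<and> (\<forall>s. u s \<in> D) \<and>
        (\<forall>U \<Phi>. (\<forall>s\<in>slab t m. U s = u s) \<longrightarrow> poly_on q (slab t m) \<Phi> \<longrightarrow> eqn m g U \<Phi>)"
      using u by blast
  qed
  then obtain P where P: "\<And>m g. m \<in> {1..M} \<Longrightarrow> poly_on q (slab t m) (P m g)"
    "\<And>m g s. m \<in> {1..M} \<Longrightarrow> P m g s \<in> D"
    "\<And>m g U \<Phi>. m \<in> {1..M} \<Longrightarrow> \<forall>s\<in>slab t m. U s = P m g s \<Longrightarrow> poly_on q (slab t m) \<Phi> \<Longrightarrow> eqn m g U \<Phi>"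
    by metis
  \<comment> \<open>\<open>e m\<close> is the value handed on at \<open>t m\<close>, starting with
    \<open>x0\<close>; slab \<open>m\<close> therefore starts from \<open>e (m - 1)\<close>.\<close>
  define e where "e = rec_nat x0 (\<lambda>m g. P (Suc m) g (t (Suc m)))"
  define U where "U = restrict (\<lambda>s. P (slab_index t s) (e (slab_index t s - 1)) s) {0<..T}"
  have U: "U s = P m (e (m - 1)) s" if "m \<in> {1..M}" "s \<in> slab t m" for m s
    using partition_slab_subset[OF part that(1)] slab_index_eq[OF part that] that(2)
    by (auto simp: U_def)
  have U_poly: "poly_on q (slab t m) U" if "m \<in> {1..M}" for m
    using P(1)[OF that, of "e (m - 1)"] U[OF that] by (simp add: poly_on_def)
  have U_D: "U s \<in> D" if "m \<in> {1..M}" "s \<in> slab t m" for m s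
    using U[OF that] P(2)[OF that(1)] by simp
  have prev_U: "prev U m = e (m - 1)" if m: "m \<in> {1..M}" for m
  proof (cases "m = 1")
    case False
    then obtain k where k: "m = Suc (Suc k)"
      using m by (cases m; cases "m - 1") auto
    have k': "Suc k \<in> {1..M}"
      using m k by simp
    have "prev U m = U (t (Suc k))"
      using prev_eq[OF m False] U_poly[OF k'] k by simp
    also have "\<dots> = e (m - 1)"
      using U[OF k', of "t (Suc k)"] slab_len[OF k'] k by (simp add: slab_def e_def)
    finally show ?thesis .
  qed (simp add: prev_def e_def)

  show ?thesis
  proof (rule ex1I[of _ U], intro conjI ballI)
    show "U \<in> pw_poly_space T M t q"
      using U_poly by (simp add: pw_poly_space_def U_def)
    show "U s \<in> D" if "m \<in> {1..M}" "s \<in> slab t m" for m s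
      by (rule U_D[OF that])
    show "quad_inner t q x w m
          (\<lambda>s. slab_deriv t m (\<lambda>r. M0 (U r)) s + M1 (U s) + A (U s)) \<Phi>
        + M0 (jump t x0 U m) \<bullet> right_limit \<Phi> (t (m - 1))
        = quad_inner t q x w m F \<Phi>" if "\<Phi> \<in> pw_poly_space T M t q" "m \<in> {1..M}" for \<Phi> m
      unfolding eqn[OF that(2)] prev_U[OF that(2)]
      using that U by (intro P(3)) (auto simp: pw_poly_space_def)
  next
    fix U' :: "real \<Rightarrow> 'h"
    assume "U' \<in> pw_poly_space T M t q \<and>
           (\<forall>m\<in>{1..M}. \<forall>s\<in>slab t m. U' s \<in> D) \<and>
           (\<forall>\<Phi>\<in>pw_poly_space T M t q. \<forall>m\<in>{1..M}.
              quad_inner t q x w m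
                (\<lambda>s. slab_deriv t m (\<lambda>r. M0 (U' r)) s + M1 (U' s) + A (U' s)) \<Phi>
              + M0 (jump t x0 U' m) \<bullet> right_limit \<Phi> (t (m - 1))
              = quad_inner t q x w m F \<Phi>)"
    then have U'_space: "U' \<in> pw_poly_space T M t q"
      and U'_D: "\<And>m s. m \<in> {1..M} \<Longrightarrow> s \<in> slab t m \<Longrightarrow> U' s \<in> D"
      and U'_eqn: "\<And>m \<Phi>. m \<in> {1..M} \<Longrightarrow> \<Phi> \<in> pw_poly_space T M t q \<Longrightarrow> eqn m (prev U' m) U' \<Phi>"
      using eqn by blast+
    have U'_poly: "poly_on q (slab t m) U'" if "m \<in> {1..M}" for m
      using U'_space that by (simp add: pw_poly_space_def)
    \<comment> \<open>Restricting the difference makes it extensional, hence an admissible test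
      function.\<close>
    define \<Phi> where "\<Phi> = restrict (\<lambda>s. U s - U' s) {0<..T}"
    have \<Phi>: "\<Phi> s = U s - U' s" if "m \<in> {1..M}" "s \<in> slab t m" for m s
      using partition_slab_subset[OF part that(1)] that(2) by (auto simp: \<Phi>_def)
    have \<Phi>_poly: "poly_on q (slab t m) \<Phi>" if m: "m \<in> {1..M}" for m
    proof -
      obtain c c' where "\<forall>s\<in>slab t m. U s = (\<Sum>k\<le>q. s ^ k *\<^sub>R c k)"
        "\<forall>s\<in>slab t m. U' s = (\<Sum>k\<le>q. s ^ k *\<^sub>R c' k)"
        using U_poly[OF m] U'_poly[OF m] unfolding poly_on_def by blast
      then have "\<forall>s\<in>slab t m. \<Phi> s = (\<Sum>k\<le>q. s ^ k *\<^sub>R (c k - c' k))"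
        using \<Phi>[OF m] by (simp add: scaleR_diff_right sum_subtractf)
      then show ?thesis
        unfolding poly_on_def by (intro exI[of _ "\<lambda>k. c k - c' k"])
    qed
    have \<Phi>_space: "\<Phi> \<in> pw_poly_space T M t q"
      using \<Phi>_poly by (simp add: pw_poly_space_def \<Phi>_def)
    \<comment> \<open>The case 0 is vacuous. Agreement on one slab gives equal incoming values on
      the next, so the one-slab uniqueness applies.\<close>
    have same: "\<forall>s\<in>slab t m. U s = U' s" if "m \<in> {1..M}" for m
      using that
    proof (induction m)
      case (Suc m)
      have prev_same: "prev U' (Suc m) = prev U (Suc m)"
      proof (cases "m = 0")
        case False
        then have m: "m \<in> {1..M}"
          using Suc.prems by simp
        then have "U (t m) = U' (t m)"
          using Suc.IH slab_len[OF m] by (simp add: slab_def)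
        then show ?thesis
          using prev_eq[OF Suc.prems] False U_poly[OF m] U'_poly[OF m] by simp
      qed (simp add: prev_def)
      have "eqn (Suc m) (prev U (Suc m)) U \<Phi>"
        unfolding prev_U[OF Suc.prems]
        using U[OF Suc.prems] \<Phi>_poly[OF Suc.prems] by (intro P(3)[OF Suc.prems]) auto
      moreover have "eqn (Suc m) (prev U (Suc m)) U' \<Phi>"
        using U'_eqn[OF Suc.prems \<Phi>_space] prev_same by simp
      ultimately show ?case
        using U_poly[OF Suc.prems] U'_poly[OF Suc.prems] \<Phi>_poly[OF Suc.prems]
          U_D[OF Suc.prems] U'_D[OF Suc.prems] \<Phi>[OF Suc.prems]
        unfolding eqn_def slab_def by (intro ballI) (rule radau_slab.slab_unique[OF slab[OF Suc.prems]])
    qed simp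
    show "U' = U"
    proof (rule extensionalityI[of _ "{0<..T}"])
      show "U' \<in> extensional {0<..T}" "U \<in> extensional {0<..T}"
        using U'_space by (auto simp: pw_poly_space_def U_def)
      show "U' s = U s" if "s \<in> {0<..T}" for s
        using same slab_index_slab[OF part that] by auto
    qed
  qed
qed

end
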